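(* Let $Q=T[H_1,\dots,H_t]$ be a strong semicomplete composition (so $T$ is a semicomplete digraph on vertices $u_1,\dots,u_t$, $t\ge 2$) and suppose $Q$ has a cycle factor. For $i\in[t]$ let $n_i=|V(H_i)|$ and let $$m_i(Q)=\max\{\,|V(\mathcal{S})\cap V(\overline{K}_{n_i})| : \mathcal{S}\text{ a cycle subdigraph of } T[\overline{K}_{n_1},\dots,\overline{K}_{n_t}]\,\},$$ and let $I(Q)=\{i\in[t] : m_i(Q)<pc(H_i)\}$. Then the minimum number $k_{\min}(Q)$ of cycles in a cycle factor of $Q$ satisfies $$k_{\min}(Q)=1+\sum_{i\in I(Q)}\min\{\,j\ge 0 : \eta_j(H_i)=m_i(Q)\,\}.$$
   Context: All digraphs are finite, without loops or parallel arcs; paths and cycles are directed, and a single vertex counts as a path. For a digraph $T$ with vertices $u_1,\dots,u_t$ ($t\ge2$) and digraphs $H_1,\dots,H_t$, the composition $Q=T[H_1,\dots,H_t]$ is obtained from disjoint copies of $H_1,\dots,H_t$ by adding, for every arc $u_iu_p$ of $T$, all arcs from every vertex of $H_i$ to every vertex of $H_p$. It is a semicomplete composition if $T$ is semicomplete (every pair of distinct vertices joined by at least one arc). $\overline{K}_n$ is the digraph on $n$ vertices with no arcs. A digraph is strong if every vertex can reach every other vertex by a path. A $k$-path-cycle subdigraph is a collection of $k$ paths and some number $t\ge 0$ of cycles, all pairwise vertex-disjoint; it is a $k$-path-cycle factor if it covers all vertices. A cycle subdigraph is a collection of pairwise vertex-disjoint cycles; a cycle factor is a spanning cycle subdigraph.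 $pc(H)$ is the smallest $k$ such that $H$ has a spanning collection of $k$ vertex-disjoint paths. For $j\ge0$, $\eta_j(H)=\min\{i : H$ has a spanning collection of $i$ paths and exactly $j$ cycles, all pairwise vertex-disjoint$\}$. *)

theory Defs
  imports Main "HOL-Library.Extended_Nat"
begin

type_synonym 'a digraph = "'a set \<times> ('a \<times> 'a) set"

definition verts :: "'a digraph \<Rightarrow> 'a set" where "verts G = fst G"
definition arcs :: "'a digraph \<Rightarrow> ('a \<times> 'a) set" where "arcs G = snd G"

definition wf_digraph :: "'a digraph \<Rightarrow> bool" where
  "wf_digraph G \<longleftrightarrow> finite (verts G) \<and> arcs G \<subseteq> verts G \<times> verts G
     \<and> (\<forall>v. (v, v) \<notin> arcs G)"

definition semicomplete :: "'a digraph \<Rightarrow> bool" where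
  "semicomplete G \<longleftrightarrow> (\<forall>u\<in>verts G. \<forall>v\<in>verts G. u \<noteq> v \<longrightarrow>
      (u, v) \<in> arcs G \<or> (v, u) \<in> arcs G)"

definition is_path :: "'a digraph \<Rightarrow> 'a list \<Rightarrow> bool" where
  "is_path G p \<longleftrightarrow> p \<noteq> [] \<and> distinct p \<and> set p \<subseteq> verts G
     \<and> (\<forall>i. Suc i < length p \<longrightarrow> (p ! i, p ! Suc i) \<in> arcs G)"

definition is_cycle :: "'a digraph \<Rightarrow> 'a list \<Rightarrow> bool" where
  "is_cycle G c \<longleftrightarrow> is_path G c \<and> (last c, hd c) \<in> arcs G"

definition strong :: "'a digraph \<Rightarrow> bool" where
  "strong G \<longleftrightarrow> (\<forall>u\<in>verts G. \<forall>v\<in>verts G. \<exists>p. is_path G p \<and> hd p = u \<and> last p = v)"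

definition path_cycle_sub :: "'a digraph \<Rightarrow> 'a list set \<Rightarrow> 'a list set \<Rightarrow> bool" where
  "path_cycle_sub G P C \<longleftrightarrow> finite P \<and> finite C \<and> P \<inter> C = {}
     \<and> (\<forall>p\<in>P. is_path G p) \<and> (\<forall>c\<in>C. is_cycle G c)
     \<and> (\<forall>x\<in>P \<union> C. \<forall>y\<in>P \<union> C. x \<noteq> y \<longrightarrow> set x \<inter> set y = {})"

definition path_cycle_factor :: "'a digraph \<Rightarrow> 'a list set \<Rightarrow> 'a list set \<Rightarrow> bool" where
  "path_cycle_factor G P C \<longleftrightarrow> path_cycle_sub G P C \<and> (\<Union>x\<in>P \<union> C. set x) = verts G"

definition cycle_subdigraph :: "'a digraph \<Rightarrow> 'a list set \<Rightarrow> bool" where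
  "cycle_subdigraph G C \<longleftrightarrow> path_cycle_sub G {} C"

definition cycle_factor :: "'a digraph \<Rightarrow> 'a list set \<Rightarrow> bool" where
  "cycle_factor G C \<longleftrightarrow> path_cycle_factor G {} C"

definition pc :: "'a digraph \<Rightarrow> nat" where
  "pc G = (LEAST k. \<exists>P. card P = k \<and> path_cycle_factor G P {})"

text \<open>eta_j(H) (infinity if no spanning collection with exactly j cycles exists).\<close>
definition eta :: "'a digraph \<Rightarrow> nat \<Rightarrow> enat" where
  "eta G j = Inf {enat i | i. \<exists>P C. card P = i \<and> card C = j \<and> path_cycle_factor G P C}"

definition composition :: "'a digraph \<Rightarrow> ('a \<Rightarrow> 'b digraph) \<Rightarrow> ('a \<times> 'b) digraph" where
  "composition T H =
    ({(u, x). u \<in> verts T \<and> x \<in> verts (H u)},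
     {((u, x), (v, y)). u \<in> verts T \<and> v \<in> verts T \<and> x \<in> verts (H u) \<and> y \<in> verts (H v)
        \<and> ((u = v \<and> (x, y) \<in> arcs (H u)) \<or> (u, v) \<in> arcs T)})"

definition empty_digraph :: "'b set \<Rightarrow> 'b digraph" where
  "empty_digraph V = (V, {})"

text \<open>m_u(Q), computed in T[\<overline>K_{n_1},...,\<overline>K_{n_t}], the copy of \<overline>K_{n_u} being {u} \<times> V(H_u).\<close>
definition m_val :: "'a digraph \<Rightarrow> ('a \<Rightarrow> 'b digraph) \<Rightarrow> 'a \<Rightarrow> nat" where
  "m_val T H u = Max {card ((\<Union>c\<in>C. set c) \<inter> ({u} \<times> verts (H u))) | C.
      cycle_subdigraph (composition T (\<lambda>v. empty_digraph (verts (H v)))) C}"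

definition I_set :: "'a digraph \<Rightarrow> ('a \<Rightarrow> 'b digraph) \<Rightarrow> 'a set" where
  "I_set T H = {u \<in> verts T. m_val T H u < pc (H u)}"

definition k_min :: "'a digraph \<Rightarrow> nat" where
  "k_min G = (LEAST k. \<exists>C. cycle_factor G C \<and> card C = k)"

end

theory Submission
  imports Defs "HOL-Combinatorics.Cycles" "HOL-Library.Multiset"
begin

text \<open>
  Lower bound: the cycles of a cycle factor that are not contained in a block cut \<open>H\<^sub>i\<close> into paths,
  and contracting these paths gives a cycle subdigraph of the composition of independent sets; so
  there are at most \<open>m\<^sub>i\<close> of them. Since opening a cycle into a path changes the number of paths by
  one, the remaining cycles inside \<open>H\<^sub>i\<close> number at least the first \<open>j\<close> with \<open>\<eta>\<^sub>j = m\<^sub>i\<close>.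

  Upper bound: it suffices to find one closed walk of \<open>T\<close> that visits every \<open>u\<^sub>i\<close> exactly \<open>m\<^sub>i\<close> times,
  because its visits to \<open>u\<^sub>i\<close> can then be replaced by \<open>m\<^sub>i\<close> disjoint paths of \<open>H\<^sub>i\<close>. A cycle subdigraph
  covering as many vertices as possible attains all \<open>m\<^sub>i\<close> simultaneously (by linear programming duality
  for permutations), and in a strong semicomplete digraph its cycles can be merged: two cycles that
  cannot be merged dominate one another in one direction only, so an irreducible family would be a
  strong tournament of cycles, which contains a cyclic triangle.
\<close>

section \<open>Closed walks and maximum weight permutations\<close>

text \<open>Each m_i is a maximum for its own block, over families that need have nothing in common;
  the construction needs one family attaining all of them, and a single closed walk out of it. The
  vertices of an independent block are interchangeable, so all that matters of such a family is how
  often each vertex of \<open>T\<close> is visited. Walks are therefore lists with repetitions, and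
  every merge preserves the multiset of visits. In the upper bound the summand 1 is the one cycle
  through all blocks. In the lower bound it has two sources. A cycle that leaves its block is
  counted by no block. If there is none, every H_i is covered by its own cycles, and as m_i is at
  least 1, one of them may be opened into a path; so each block has at least one cycle more than its
  term demands.\<close>

definition closed_walk :: "('a \<Rightarrow> 'a \<Rightarrow> bool) \<Rightarrow> 'a list \<Rightarrow> bool" where
  "closed_walk R w \<longleftrightarrow> w \<noteq> [] \<and> successively R w \<and> R (last w) (hd w)"

lemma closed_walk_map: "closed_walk R (map f w) \<longleftrightarrow> closed_walk (\<lambda>x y. R (f x) (f y)) w"
  by (auto simp: closed_walk_def successively_map last_map hd_map)

text \<open>Zipping a list with its rotation lists all arcs including the closing one, which then
  needs no separate treatment.\<close>

lemma closed_walk_iff_rotate1: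
  "closed_walk R w \<longleftrightarrow> w \<noteq> [] \<and> (\<forall>(x, y)\<in>set (zip w (rotate1 w)). R x y)"
proof -
  have "(\<forall>(x, y)\<in>set (zip (x # zs) (zs @ [a])). R x y)
      \<longleftrightarrow> successively R (x # zs) \<and> R (last (x # zs)) a" for x a zs
    by (induction zs arbitrary: x) auto
  then show ?thesis by (cases w) (auto simp: closed_walk_def)
qed

text \<open>Bridge between walks and permutations: along a cycle of \<open>f\<close> the arcs are
  the pairs of \<open>x\<close> and \<open>f x\<close>.\<close>

lemma closed_walk_iff_succ_map:
  assumes "map f w = rotate1 w"
  shows "closed_walk R w \<longleftrightarrow> w \<noteq> [] \<and> (\<forall>x\<in>set w. R x (f x))"
  unfolding closed_walk_iff_rotate1 assms[symmetric]
  by (auto simp: zip_map2 zip_same_conv_map)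

section \<open>Potentials and duality for maximum weight permutations\<close>

fun walk_weight :: "('a \<Rightarrow> 'a \<Rightarrow> int) \<Rightarrow> 'a list \<Rightarrow> int" where
  "walk_weight l (x # y # zs) = l x y + walk_weight l (y # zs)"
| "walk_weight l zs = 0"

lemma walk_weight_append:
  "walk_weight l (xs @ y # ys) = walk_weight l (xs @ [y]) + walk_weight l (y # ys)"
  by (induction l "xs @ [y]" arbitrary: xs rule: walk_weight.induct)
     (auto simp: Cons_eq_append_conv append_eq_Cons_conv neq_Nil_conv)

lemma walk_weight_conv_sum_list:
  assumes "xs \<noteq> []"
  shows "walk_weight l xs + l (last xs) (hd xs) = (\<Sum>(x, y)\<leftarrow>zip xs (rotate1 xs). l x y)"
proof -
  have "walk_weight l (x # zs) + l (last (x # zs)) a = (\<Sum>(x, y)\<leftarrow>zip (x # zs) (zs @ [a]). l x y)"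
    for x a zs
    by (induction zs arbitrary: x) auto
  then show ?thesis using assms by (cases xs) auto
qed

text \<open>Bellman-Ford: the potential of \<open>y\<close> is the largest weight of a path ending
  in \<open>y\<close>. Restricting to distinct lists makes the maximum exist, and longer walks gain
  nothing because cycles have weight at most 0.\<close>

lemma potential_of_nonpositive_cycles:
  fixes l :: "'a \<Rightarrow> 'a \<Rightarrow> int"
  assumes fin: "finite V"
    and cyc: "\<And>c. \<lbrakk>closed_walk R c; distinct c; set c \<subseteq> V\<rbrakk>
              \<Longrightarrow> walk_weight l c + l (last c) (hd c) \<le> 0"
  shows "\<exists>p. \<forall>x\<in>V. \<forall>y\<in>V. R x y \<longrightarrow> p y \<ge> p x + l x y"
proof -
  define W where "W y = {c. c \<noteq> [] \<and> distinct c \<and> set c \<subseteq> V \<and> successively R c \<and> last c = y}" for y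
  have finW: "finite (W y)" for y
    by (rule finite_subset[OF _ finite_subset_distinct[OF fin]]) (auto simp: W_def)
  define p where "p y = Max (walk_weight l ` W y)" for y
  have "p y \<ge> p x + l x y" if x: "x \<in> V" and y: "y \<in> V" and r: "R x y" for x y
  proof -
    have "[x] \<in> W x" using x by (auto simp: W_def)
    then have "p x \<in> walk_weight l ` W x"
      unfolding p_def using finW by (intro Max_in) auto
    then obtain c where c: "c \<noteq> []" "distinct c" "set c \<subseteq> V" "successively R c" "last c = x"
      and px: "p x = walk_weight l c"
      by (auto simp: W_def)
    have ge: "p y \<ge> walk_weight l d" if "d \<in> W y" for d
      unfolding p_def using that finW by auto
    obtain c' where c': "c = c' @ [x]"
      using c(1,5) by (metis append_butlast_last_id)
    show ?thesis
    proof (cases "y \<in> set c")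
      case False
      have "c @ [y] \<in> W y"
        using c False y r by (simp add: W_def successively_append_iff)
      from ge[OF this] show ?thesis
        using px c' walk_weight_append[of l c' x "[y]"] by simp
    next
      case True
      \<comment> \<open>Going on to \<open>y\<close> closes the cycle \<open>y # b\<close>; dropping
        it costs nothing and leaves the path \<open>a @ [y]\<close>.\<close>
      then obtain a b where ab: "c = a @ y # b" by (meson split_list)
      have 1: "a @ [y] \<in> W y"
        using c unfolding ab by (simp add: W_def successively_append_iff)
      have lst: "last (y # b) = x" using c(5) unfolding ab by simp
      have "successively R (y # b)" "distinct (y # b)" "set (y # b) \<subseteq> V"
        using c unfolding ab by (simp_all add: successively_append_iff)
      then have "walk_weight l (y # b) + l (last (y # b)) (hd (y # b)) \<le> 0"
        using r lst by (intro cyc) (simp_all add: closed_walk_def)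
      then show ?thesis
        using ge[OF 1] px walk_weight_append[of l a y b] lst unfolding ab by simp
    qed
  qed
  then show ?thesis by blast
qed

text \<open>Linear programming duality for the assignment problem: a maximum admits no improving
  exchange cycle, so the exchange digraph of \<open>f\<close> has a potential, which yields dual
  variables that are tight on \<open>f\<close>.\<close>

lemma max_weight_permutation_potentials:
  fixes w :: "'a \<Rightarrow> 'a \<Rightarrow> int"
  assumes fin: "finite V" and f: "f permutes V" and fE: "\<And>x. x \<in> V \<Longrightarrow> E x (f x)"
    and max: "\<And>g. \<lbrakk>g permutes V; \<And>x. x \<in> V \<Longrightarrow> E x (g x)\<rbrakk>
              \<Longrightarrow> (\<Sum>x\<in>V. w x (g x)) \<le> (\<Sum>x\<in>V. w x (f x))"
  obtains \<alpha> \<beta> :: "'a \<Rightarrow> int"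
  where "\<And>x y. \<lbrakk>x \<in> V; y \<in> V; E x y\<rbrakk> \<Longrightarrow> \<alpha> x + \<beta> y \<ge> w x y"
    and "\<And>x. x \<in> V \<Longrightarrow> \<alpha> x + \<beta> (f x) = w x (f x)"
proof -
  \<comment> \<open>The gain when \<open>x\<close> gives up its image for that of \<open>y\<close>;
    performing a cycle \<open>s\<close> of such exchanges gives the permutation
    \<open>f \<circ> s\<close>.\<close>
  define l where "l x y = w x (f y) - w x (f x)" for x y
  have "\<exists>p. \<forall>x\<in>V. \<forall>y\<in>V. E x (f y) \<longrightarrow> p y \<ge> p x + l x y"
  proof (rule potential_of_nonpositive_cycles[OF fin])
    fix c assume c: "closed_walk (\<lambda>x y. E x (f y)) c" "distinct c" "set c \<subseteq> V"
    define s where "s = cycle_of_list c"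
    have rot: "map s c = rotate1 c" using cyclic_rotation[OF c(2), of 1] by (simp add: s_def)
    have sV: "s permutes V"
      using cycle_permutes[of c] c(3) by (auto simp: s_def intro: permutes_subset)
    have ne: "c \<noteq> []" and E: "\<And>x. x \<in> set c \<Longrightarrow> E x (f (s x))"
      using c(1) closed_walk_iff_succ_map[OF rot, of "\<lambda>x y. E x (f y)"] by simp_all
    have id: "s x = x" if "x \<notin> set c" for x using that by (simp add: s_def id_outside_supp)
    have "(\<Sum>x\<in>V. w x ((f \<circ> s) x)) \<le> (\<Sum>x\<in>V. w x (f x))"
    proof (intro max permutes_compose sV f)
      show "E x ((f \<circ> s) x)" if "x \<in> V" for x
        using E[of x] id[of x] fE[OF that] by (cases "x \<in> set c") auto
    qed
    then have "(\<Sum>x\<in>V. l x (s x)) \<le> 0" by (simp add: l_def sum_subtractf)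
    also have "(\<Sum>x\<in>V. l x (s x)) = (\<Sum>x\<in>set c. l x (s x))"
      using fin c(3) id by (intro sum.mono_neutral_right) (auto simp: l_def)
    also have "\<dots> = (\<Sum>x\<leftarrow>c. l x (s x))" using c(2) by (simp add: sum_list_distinct_conv_sum_set)
    also have "\<dots> = (\<Sum>(x, y)\<leftarrow>zip c (map s c). l x y)"
      by (induction c) auto
    also have "\<dots> = walk_weight l c + l (last c) (hd c)"
      using walk_weight_conv_sum_list[OF ne] rot by simp
    finally show "walk_weight l c + l (last c) (hd c) \<le> 0" .
  qed
  then obtain p where p: "\<And>x y. \<lbrakk>x \<in> V; y \<in> V; E x (f y)\<rbrakk> \<Longrightarrow> p y \<ge> p x + l x y" by blast
  \<comment> \<open>The potential of \<open>x\<close> becomes \<beta> at \<open>f x\<close>;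
    tightness on \<open>f\<close> then dictates \<alpha>.\<close>
  define \<beta> where "\<beta> y = p (inv f y)" for y
  define \<alpha> where "\<alpha> x = w x (f x) - p x" for x
  have "\<alpha> x + \<beta> y \<ge> w x y" if "x \<in> V" "y \<in> V" "E x y" for x y
    using p[of x "inv f y"] that f
    by (simp add: \<alpha>_def \<beta>_def l_def permutes_inverses permutes_in_image[OF permutes_inv[OF f]])
  moreover have "\<alpha> x + \<beta> (f x) = w x (f x)" if "x \<in> V" for x
    using f by (simp add: \<alpha>_def \<beta>_def permutes_inverses)
  ultimately show ?thesis using that by blast
qed

section \<open>Circulations across a cut, and the block sizes of a maximum family\<close>

lemma card_permutes_preimage:
  assumes "g permutes V" "S \<subseteq> V"
  shows "card {x \<in> V. g x \<in> S} = card S"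
proof -
  have "{x \<in> V. g x \<in> S} = g -` S" using assms by (auto simp: permutes_in_image)
  then show ?thesis
    by (simp add: card_vimage_inj permutes_inj[OF assms(1)] permutes_surj[OF assms(1)])
qed

text \<open>\<open>A\<close> has as many preimages as elements, and the arcs inside \<open>A\<close>
  cancel.\<close>

lemma card_leaving_eq_card_entering:
  assumes "finite V" "g permutes V" "A \<subseteq> V"
  shows "card {x \<in> A. g x \<notin> A} = card {x \<in> V - A. g x \<in> A}"
proof -
  have finA: "finite A" using assms finite_subset by blast
  have "card {x \<in> V. g x \<in> A} = card A" by (rule card_permutes_preimage[OF assms(2,3)])
  moreover have "{x \<in> V. g x \<in> A} = {x \<in> A. g x \<in> A} \<union> {x \<in> V - A. g x \<in> A}"
    using assms(3) by auto
  moreover have "A = {x \<in> A. g x \<in> A} \<union> {x \<in> A. g x \<notin> A}" by auto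
  moreover have "card ({x \<in> A. g x \<in> A} \<union> {x \<in> V - A. g x \<in> A})
      = card {x \<in> A. g x \<in> A} + card {x \<in> V - A. g x \<in> A}"
    using finA assms(1) by (intro card_Un_disjoint) auto
  moreover have "card ({x \<in> A. g x \<in> A} \<union> {x \<in> A. g x \<notin> A})
      = card {x \<in> A. g x \<in> A} + card {x \<in> A. g x \<notin> A}"
    using finA by (intro card_Un_disjoint) auto
  ultimately show ?thesis by simp
qed

text \<open>A family of disjoint cycles is encoded as a permutation whose fixed points are the vertices that
  the family does not cover; \<open>b\<close> maps a vertex to its block.\<close>

definition loopy_factor :: "'v set \<Rightarrow> ('v \<Rightarrow> 'a) \<Rightarrow> ('a \<Rightarrow> 'a \<Rightarrow> bool) \<Rightarrow> ('v \<Rightarrow> 'v) \<Rightarrow> bool" where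
  "loopy_factor V b R f \<longleftrightarrow> f permutes V \<and> (\<forall>x\<in>V. f x = x \<or> R (b x) (b (f x)))"

text \<open>Potentials certify the maximality of \<open>f\<close>. Normalize them to vanish at a vertex \<open>v\<close> of the block
  that \<open>f\<close> leaves uncovered. As every vertex outside the block is adjacent to \<open>v\<close>, it has \<open>\<alpha> \<ge> 1\<close> or
  \<open>\<beta> \<ge> 1\<close>, and the vertices satisfying both form a cut that no circulation through the block can
  avoid and that \<open>f\<close> saturates.\<close>

lemma max_loopy_factor_covers_blocks:
  assumes fin: "finite V" and irr: "\<And>u. \<not> R u u"
    and semi: "\<And>x y. \<lbrakk>x \<in> V; y \<in> V; b x \<noteq> b y\<rbrakk> \<Longrightarrow> R (b x) (b y) \<or> R (b y) (b x)"
    and f: "loopy_factor V b R f"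
    and max: "\<And>g. loopy_factor V b R g \<Longrightarrow> card {x \<in> V. g x \<noteq> x} \<le> card {x \<in> V. f x \<noteq> x}"
    and g: "loopy_factor V b R g"
  shows "card {x \<in> V. b x = u \<and> g x \<noteq> x} \<le> card {x \<in> V. b x = u \<and> f x \<noteq> x}"
proof (cases "\<exists>v\<in>V. b v = u \<and> f v = v")
  case False
  then show ?thesis using fin by (intro card_mono) auto
next
  case True
  then obtain v where v: "v \<in> V" "b v = u" "f v = v" by blast
  \<comment> \<open>With this weight a maximum permutation is one that moves, hence covers, most
    vertices.\<close>
  define w :: "'a \<Rightarrow> 'a \<Rightarrow> int" where "w x y = of_bool (y \<noteq> x)" for x y
  have fp: "f permutes V" and gp: "g permutes V" using f g by (auto simp: loopy_factor_def)
  have sumw: "(\<Sum>x\<in>V. w x (h x)) = int (card {x \<in> V. h x \<noteq> x})" for h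
    using fin by (simp add: w_def Int_def)
  obtain \<alpha>' \<beta>' :: "'a \<Rightarrow> int" where
    pot': "\<And>x y. \<lbrakk>x \<in> V; y \<in> V; y = x \<or> R (b x) (b y)\<rbrakk> \<Longrightarrow> \<alpha>' x + \<beta>' y \<ge> w x y" and
    tight': "\<And>x. x \<in> V \<Longrightarrow> \<alpha>' x + \<beta>' (f x) = w x (f x)"
  proof (rule max_weight_permutation_potentials[OF fin fp, of "\<lambda>x y. y = x \<or> R (b x) (b y)" w])
    show "f x = x \<or> R (b x) (b (f x))" if "x \<in> V" for x
      using f that by (auto simp: loopy_factor_def)
    show "(\<Sum>x\<in>V. w x (h x)) \<le> (\<Sum>x\<in>V. w x (f x))"
      if "h permutes V" "\<And>x. x \<in> V \<Longrightarrow> h x = x \<or> R (b x) (b (h x))" for h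
      using max[of h] that by (simp add: sumw loopy_factor_def)
  qed blast
  \<comment> \<open>The shift leaves all sums of an \<alpha> and a \<beta> unchanged. The loop at
    \<open>v\<close> belongs to \<open>f\<close> and has weight 0, so \<beta> vanishes at
    \<open>v\<close> together with \<alpha>.\<close>
  define \<alpha> where "\<alpha> x = \<alpha>' x - \<alpha>' v" for x
  define \<beta> where "\<beta> x = \<beta>' x + \<alpha>' v" for x
  have pot: "\<alpha> x + \<beta> y \<ge> 1" if "x \<in> V" "y \<in> V" "R (b x) (b y)" for x y
    using pot'[of x y] that irr[of "b x"]
    by (cases "y = x") (auto simp: \<alpha>_def \<beta>_def w_def)
  have tight1: "\<alpha> x + \<beta> (f x) = 1" if "x \<in> V" "f x \<noteq> x" for x
    using tight'[of x] that by (auto simp: \<alpha>_def \<beta>_def w_def)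
  have tight0: "\<alpha> x + \<beta> x = 0" if "x \<in> V" "f x = x" for x
    using tight'[of x] that by (auto simp: \<alpha>_def \<beta>_def w_def)
  have v0: "\<alpha> v = 0" "\<beta> v = 0" using tight0[OF v(1,3)] by (auto simp: \<alpha>_def)
  define A where "A = {x \<in> V. b x \<noteq> u \<and> \<alpha> x \<ge> 1}"
  define K where "K = {x \<in> A. \<beta> x \<ge> 1}"
  have AV: "A \<subseteq> V" and KA: "K \<subseteq> A" by (auto simp: A_def K_def)
  have into_u: "\<alpha> x \<ge> 1" if "x \<in> V" "R (b x) u" for x
    using pot[of x v] that v v0 by auto
  have from_u: "\<beta> y \<ge> 1" if "y \<in> V" "R u (b y)" for y
    using pot[of v y] that v v0 by auto
  have AB: "\<alpha> x \<ge> 1 \<or> \<beta> x \<ge> 1" if "x \<in> V" "b x \<noteq> u" for x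
    using semi[of x v] into_u from_u that v by auto
  have fV: "f x \<in> V" and gV: "g x \<in> V" if "x \<in> V" for x
    using fp gp that by (auto simp: permutes_in_image)
  have fR: "R (b x) (b (f x))" if "x \<in> V" "f x \<noteq> x" for x
    using f that by (auto simp: loopy_factor_def)
  have gR: "R (b x) (b (g x))" if "x \<in> V" "g x \<noteq> x" for x
    using g that by (auto simp: loopy_factor_def)
  note finites = finite_subset[OF AV fin]
  have card_block: "card {x \<in> V. h x \<noteq> x \<and> b (h x) = u} = card {x \<in> V. b x = u \<and> h x \<noteq> x}"
    if h: "h permutes V" for h
  proof -
    have "{x \<in> V. h x \<noteq> x \<and> b (h x) = u} = {x \<in> V. h x \<in> {y \<in> V. b y = u \<and> h y \<noteq> y}}"
      using h by (auto simp: permutes_in_image inj_eq[OF permutes_inj[OF h]])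
    then show ?thesis
      using card_permutes_preimage[OF h, of "{y \<in> V. b y = u \<and> h y \<noteq> y}"] by auto
  qed
  \<comment> \<open>A vertex preceding the block has \<alpha> \<ge> 1 and, \<open>R\<close> being
    irreflexive, lies outside the block; so each visit costs an arc leaving
    \<open>A\<close>.\<close>
  have "card {x \<in> V. b x = u \<and> g x \<noteq> x} \<le> card {x \<in> A. g x \<notin> A}"
    unfolding card_block[OF gp, symmetric]
  proof (intro card_mono)
    show "{x \<in> V. g x \<noteq> x \<and> b (g x) = u} \<subseteq> {x \<in> A. g x \<notin> A}"
      using gR irr into_u unfolding A_def by (smt (verit) mem_Collect_eq subsetI)
  qed (use finites in auto)
  also have "\<dots> = card {x \<in> V - A. g x \<in> A}"
    by (rule card_leaving_eq_card_entering[OF fin gp AV])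
  also have "\<dots> \<le> card {x \<in> V. g x \<in> K}"
  proof (intro card_mono)
    show "{x \<in> V - A. g x \<in> A} \<subseteq> {x \<in> V. g x \<in> K}"
    proof safe
      fix x assume x: "x \<in> V" "x \<notin> A" "g x \<in> A"
      then have r: "R (b x) (b (g x))" using gR by metis
      have "\<beta> (g x) \<ge> 1"
      proof (cases "b x = u")
        case True then show ?thesis using from_u r gV x by auto
      next
        case False
        then have "\<alpha> x \<le> 0" using x by (auto simp: A_def)
        then show ?thesis using pot[OF x(1) gV[OF x(1)] r] by simp
      qed
      then show "g x \<in> K" using x by (simp add: K_def)
    qed
  qed (use fin in auto)
  \<comment> \<open>Every permutation has exactly \<open>card K\<close> arcs into \<open>K\<close>,
    loops included; this is where the count passes from \<open>g\<close> to
    \<open>f\<close>.\<close>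
  also have "\<dots> = card K" using card_permutes_preimage[OF gp] KA AV by auto
  also have "\<dots> = card {x \<in> V. f x \<in> K}" using card_permutes_preimage[OF fp] KA AV by auto
  \<comment> \<open>Arcs from \<open>A\<close> into \<open>K\<close> and loops in \<open>K\<close>
    would have sum at least 2, but on \<open>f\<close> the sums are 1 and 0.\<close>
  also have "\<dots> \<le> card {x \<in> V - A. f x \<in> A}"
  proof (intro card_mono)
    show "{x \<in> V. f x \<in> K} \<subseteq> {x \<in> V - A. f x \<in> A}"
    proof safe
      fix x assume x: "x \<in> V" "f x \<in> K"
      then show "f x \<in> A" by (simp add: K_def)
      assume "x \<in> A"
      have "f x \<noteq> x" using tight0[of x] x by (auto simp: K_def A_def)
      then show False using tight1[of x] x \<open>x \<in> A\<close> by (auto simp: K_def A_def)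
    qed
  qed (use fin in auto)
  also have "\<dots> = card {x \<in> A. f x \<notin> A}"
    by (rule card_leaving_eq_card_entering[OF fin fp AV, symmetric])
  \<comment> \<open>An arc of \<open>f\<close> leaving \<open>A\<close> is tight, so its head has
    \<beta> \<le> 0; outside the block the head would then have \<alpha> \<ge> 1 and lie in
    \<open>A\<close>.\<close>
  also have "\<dots> \<le> card {x \<in> V. f x \<noteq> x \<and> b (f x) = u}"
  proof (intro card_mono)
    show "{x \<in> A. f x \<notin> A} \<subseteq> {x \<in> V. f x \<noteq> x \<and> b (f x) = u}"
    proof safe
      fix x assume x: "x \<in> A" "f x \<notin> A"
      then show "x \<in> V" "f x = x \<Longrightarrow> False" by (auto simp: A_def)
      have "f x \<noteq> x" using x by metis
      moreover have "x \<in> V" "\<alpha> x \<ge> 1" using x by (auto simp: A_def)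
      ultimately have "\<not> \<beta> (f x) \<ge> 1" "f x \<in> V" using tight1[of x] fV by auto
      then show "b (f x) = u" using AB[of "f x"] x by (auto simp: A_def)
    qed
  qed (use fin in auto)
  also have "\<dots> = card {x \<in> V. b x = u \<and> f x \<noteq> x}" by (rule card_block[OF fp])
  finally show ?thesis .
qed

section \<open>Merging closed walks\<close>

text \<open>A relation rather than a function, since a vertex visited several times has several
  successors; indices modulo the length include the closing arc.\<close>

definition cyc_succ :: "'a list \<Rightarrow> 'a \<Rightarrow> 'a \<Rightarrow> bool" where
  "cyc_succ w x y \<longleftrightarrow> w \<noteq> [] \<and>
     (\<exists>i. x = w ! (i mod length w) \<and> y = w ! (Suc i mod length w))"

lemma mset_rotate [simp]: "mset (rotate n w) = mset w"
proof -
  have "mset (rotate1 v) = mset v" for v :: "'a list" by (cases v) auto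
  then show ?thesis by (induction n) auto
qed

lemma closed_walk_append:
  assumes "xs \<noteq> []" "ys \<noteq> []"
  shows "closed_walk R (xs @ ys) \<longleftrightarrow>
    successively R xs \<and> successively R ys \<and> R (last xs) (hd ys) \<and> R (last ys) (hd xs)"
  using assms by (auto simp: closed_walk_def successively_append_iff)

lemma closed_walk_rotate: "closed_walk R w \<Longrightarrow> closed_walk R (rotate n w)"
proof -
  have "closed_walk R (rotate1 w)" if "closed_walk R w" for w
  proof (cases w)
    case (Cons x xs)
    then show ?thesis
      using that closed_walk_append[of "[x]" xs R] closed_walk_append[of xs "[x]" R]
      by (cases "xs = []") auto
  qed (use that in \<open>simp add: closed_walk_def\<close>)
  then show "closed_walk R w \<Longrightarrow> closed_walk R (rotate n w)" by (induction n) auto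
qed

text \<open>Makes a chosen arc the closing one, so that splicing there becomes list
  concatenation.\<close>

lemma cyc_succ_rotation:
  assumes "cyc_succ w x y"
  obtains n where "last (rotate n w) = x" "hd (rotate n w) = y"
proof -
  obtain i where w: "w \<noteq> []" and i: "x = w ! (i mod length w)" "y = w ! (Suc i mod length w)"
    using assms by (auto simp: cyc_succ_def)
  have "last (rotate (Suc i) w) = w ! ((Suc i + (length w - 1)) mod length w)"
    using w by (subst last_conv_nth) (simp_all add: nth_rotate del: rotate_Suc)
  also have "Suc i + (length w - 1) = i + length w" using w by (cases w) auto
  finally show ?thesis
    using that[of "Suc i"] i w hd_rotate_conv_nth[OF w, of "Suc i"] by simp
qed

lemma cyc_succ_rotate:
  assumes "cyc_succ w x y"
  shows "cyc_succ (rotate m w) x y"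
proof -
  obtain i where w: "w \<noteq> []" and i: "x = w ! (i mod length w)" "y = w ! (Suc i mod length w)"
    using assms by (auto simp: cyc_succ_def)
  \<comment> \<open>An index with \<open>m + j\<close> congruent to \<open>i\<close> modulo the
    length, avoiding the subtraction of \<open>m\<close> from \<open>i\<close>.\<close>
  define j where "j = i + m * (length w - 1)"
  have eq: "m + j = i + m * length w"
    using w by (cases w) (auto simp: j_def algebra_simps)
  have nth: "rotate m w ! (k mod length w) = w ! ((m + k) mod length w)" for k
    using w by (simp add: nth_rotate mod_add_right_eq)
  have "rotate m w ! (j mod length w) = x" "rotate m w ! (Suc j mod length w) = y"
    using i eq by (auto simp: nth)
  then show ?thesis using w by (auto simp: cyc_succ_def)
qed

lemma cyc_succ_arc: "closed_walk R w \<Longrightarrow> cyc_succ w x y \<Longrightarrow> R x y"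
  by (metis closed_walk_def closed_walk_rotate cyc_succ_rotation)

lemma cyc_succ_in_set: "cyc_succ w x y \<Longrightarrow> x \<in> set w \<and> y \<in> set w"
  by (auto simp: cyc_succ_def)

lemma ex_cyc_succ: "x \<in> set w \<Longrightarrow> \<exists>y. cyc_succ w x y"
  unfolding cyc_succ_def by (metis in_set_conv_nth mod_less list.size(3) not_less0)

lemma ex_cyc_pred:
  assumes "y \<in> set w"
  shows "\<exists>x. cyc_succ w x y"
proof -
  obtain j where j: "j < length w" "y = w ! j" using assms by (auto simp: in_set_conv_nth)
  have "Suc (j + length w - 1) = j + length w" using j by linarith
  then have "Suc (j + length w - 1) mod length w = j" using j by simp
  moreover have "w \<noteq> []" using j by auto
  ultimately show ?thesis unfolding cyc_succ_def using j by metis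
qed

lemma cyc_succ_induct:
  assumes "x \<in> set w" "P x" and step: "\<And>y z. cyc_succ w y z \<Longrightarrow> P y \<Longrightarrow> P z" and "z \<in> set w"
  shows "P z"
proof -
  obtain i where i: "i < length w" "x = w ! i" using assms(1) by (auto simp: in_set_conv_nth)
  obtain j where j: "j < length w" "z = w ! j" using assms(4) by (auto simp: in_set_conv_nth)
  have w: "w \<noteq> []" using i by auto
  have "P (w ! ((i + k) mod length w))" for k
  proof (induction k)
    case 0 then show ?case using i assms(2) by simp
  next
    case (Suc k)
    have "cyc_succ w (w ! ((i + k) mod length w)) (w ! (Suc (i + k) mod length w))"
      using w by (auto simp: cyc_succ_def)
    from step[OF this Suc] show ?case by simp
  qed
  from this[of "length w - i + j"] show ?thesis using i j by simp
qed

lemma cyc_succ_append: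
  assumes "cyc_succ w x y" "(x, y) \<noteq> (last w, hd w)"
  shows "cyc_succ (w @ p) x y"
proof -
  obtain i where w: "w \<noteq> []" and i: "x = w ! (i mod length w)" "y = w ! (Suc i mod length w)"
    using assms by (auto simp: cyc_succ_def)
  define j where "j = i mod length w"
  have j: "j < length w" "x = w ! j" "y = w ! (Suc j mod length w)"
    using w i by (auto simp: j_def mod_Suc_eq)
  have "Suc j < length w"
  proof (rule ccontr)
    assume "\<not> Suc j < length w"
    then have "Suc j = length w" using j by simp
    then have "j = length w - 1" "Suc j mod length w = 0" by auto
    then show False using assms(2) j w by (auto simp: last_conv_nth hd_conv_nth)
  qed
  then have "x = (w @ p) ! (j mod length (w @ p))" "y = (w @ p) ! (Suc j mod length (w @ p))"
    using j by (auto simp: nth_append)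
  then show ?thesis using w unfolding cyc_succ_def by blast
qed

text \<open>A segment of \<open>p\<close> that starts with \<open>x\<close> and ends with the last vertex dominating \<open>z\<close> is put
  between \<open>y\<close> and \<open>z\<close>; no later vertex of \<open>p\<close> needs the destroyed arc \<open>yz\<close>.\<close>

lemma insert_walk_into_closed_walk:
  assumes "closed_walk R w" "successively R p"
    and "\<And>x. x \<in> set p \<Longrightarrow> \<exists>y z. cyc_succ w y z \<and> R y x \<and> R x z"
  shows "\<exists>w'. closed_walk R w' \<and> mset w' = mset w + mset p"
  using assms
proof (induction p arbitrary: w rule: length_induct)
  case (1 p)
  show ?case
  proof (cases "p = []")
    case True
    then show ?thesis using 1 by auto
  next
    case False
    then obtain y z where yz: "cyc_succ w y z" "R y (hd p)" "R (hd p) z"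
      using "1.prems"(3)[of "hd p"] by auto
    obtain n where n: "last (rotate n w) = y" "hd (rotate n w) = z"
      using yz(1) by (rule cyc_succ_rotation)
    have "\<exists>x\<in>set p. R x z" using yz False by (meson hd_in_set)
    then obtain a x b where p: "p = a @ x # b" "R x z" "\<forall>x'\<in>set b. \<not> R x' z"
      using split_list_last_prop[of p "\<lambda>x. R x z"] by blast
    define w' where "w' = rotate n w @ a @ [x]"
    have w: "closed_walk R (rotate n w)" "rotate n w \<noteq> []"
      using "1.prems"(1) closed_walk_rotate[of R w n] by (auto simp: closed_walk_def)
    have "successively R (a @ [x])" using "1.prems"(2) p by (simp add: successively_append_iff)
    moreover have "hd (a @ [x]) = hd p" by (cases a) (auto simp: p)
    ultimately have cw: "closed_walk R w'"
      unfolding w'_def using w yz p(2) n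
      by (subst closed_walk_append) (auto simp: closed_walk_def)
    have "\<exists>y z. cyc_succ w' y z \<and> R y x' \<and> R x' z" if x': "x' \<in> set b" for x'
    proof -
      obtain y' z' where *: "cyc_succ w y' z'" "R y' x'" "R x' z'"
        using "1.prems"(3)[of x'] x' p by auto
      have "(y', z') \<noteq> (last (rotate n w), hd (rotate n w))" using p(3) x' * n by auto
      from cyc_succ_append[OF cyc_succ_rotate[OF *(1)] this]
      show ?thesis using * by (auto simp: w'_def)
    qed
    moreover have "successively R b" "length b < length p"
      using "1.prems"(2) p by (auto simp: successively_append_iff successively_Cons)
    ultimately obtain w'' where "closed_walk R w''" "mset w'' = mset w' + mset b"
      using "1.IH" cw by blast
    then show ?thesis by (auto simp: w'_def p)
  qed
qed

text \<open>Trades the arcs from x to x' and from y to y' for those from x to y' and from y to x',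
  which links the two walks into one.\<close>

lemma merge_exchange:
  assumes "closed_walk R v" "closed_walk R w" "cyc_succ v x x'" "cyc_succ w y y'" "R x y'" "R y x'"
  shows "\<exists>u. closed_walk R u \<and> mset u = mset v + mset w"
proof -
  obtain n where n: "last (rotate n v) = x" "hd (rotate n v) = x'"
    using assms(3) by (rule cyc_succ_rotation)
  obtain m where m: "last (rotate m w) = y" "hd (rotate m w) = y'"
    using assms(4) by (rule cyc_succ_rotation)
  have "closed_walk R (rotate n v)" "closed_walk R (rotate m w)"
    using assms(1,2) by (auto intro: closed_walk_rotate)
  then have "closed_walk R (rotate n v @ rotate m w)"
    using n m assms(5,6) by (subst closed_walk_append) (auto simp: closed_walk_def)
  then show ?thesis by (metis mset_append mset_rotate)
qed

text \<open>Arcs in both directions between two vertices are allowed, so domination is stated as the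
  absence of arcs back. If arcs run both ways between the walks, the impossibility of an exchange
  propagates along them until every vertex of \<open>v\<close> fits between two consecutive vertices
  of \<open>w\<close>; then \<open>v\<close> can be inserted.\<close>

lemma merge_closed_walks_or_dominate:
  assumes v: "closed_walk R v" and w: "closed_walk R w"
    and adj: "\<And>x y. x \<in> set v \<Longrightarrow> y \<in> set w \<Longrightarrow> R x y \<or> R y x"
  shows "(\<exists>u. closed_walk R u \<and> mset u = mset v + mset w)
    \<or> (\<forall>x\<in>set v. \<forall>y\<in>set w. \<not> R y x) \<or> (\<forall>x\<in>set v. \<forall>y\<in>set w. \<not> R x y)"
proof (rule ccontr)
  assume contra: "\<not> ?thesis"
  have no_exchange: False if "cyc_succ v x x'" "cyc_succ w y y'" "R x y'" "R y x'" for x x' y y'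
    using merge_exchange[OF v w that] contra by blast
  have inn: "\<exists>y\<in>set w. R y x" if x: "x \<in> set v" for x
  proof (rule ccontr)
    assume *: "\<not> (\<exists>y\<in>set w. R y x)"
    \<comment> \<open>Here \<open>a\<close> dominates all of \<open>w\<close>, so an arc from
      \<open>y\<close> to \<open>b\<close> and one from \<open>a\<close> to the successor of
      \<open>y\<close> would form an exchange.\<close>
    have "\<forall>y\<in>set w. \<not> R y b" if ab: "cyc_succ v a b" "\<forall>y\<in>set w. \<not> R y a" for a b
    proof safe
      fix y assume y: "y \<in> set w" "R y b"
      obtain y' where y': "cyc_succ w y y'" using ex_cyc_succ y by metis
      then have "R a y'" using ab adj cyc_succ_in_set by metis
      then show False using no_exchange ab y y' by blast
    qed
    then have "\<forall>y\<in>set w. \<not> R y x'" if "x' \<in> set v" for x'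
      using cyc_succ_induct[of x v "\<lambda>x. \<forall>y\<in>set w. \<not> R y x"] x * that by blast
    then show False using contra by blast
  qed
  have out: "\<exists>y\<in>set w. R x y" if x: "x \<in> set v" for x
  proof -
    obtain x0 where x0: "x0 \<in> set v" "\<exists>y\<in>set w. R x0 y" using contra by blast
    \<comment> \<open>If \<open>b\<close> had no out-neighbour on \<open>w\<close>, the predecessor
      of \<open>y\<close> would dominate \<open>b\<close>, and with the arc from \<open>a\<close> to
      \<open>y\<close> this is an exchange.\<close>
    have "\<exists>y\<in>set w. R b y" if ab: "cyc_succ v a b" "\<exists>y\<in>set w. R a y" for a b
    proof (rule ccontr)
      assume *: "\<not> ?thesis"
      obtain y where y: "y \<in> set w" "R a y" using ab by blast
      obtain y' where y': "cyc_succ w y' y" using ex_cyc_pred y by metis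
      then have "R y' b" using * ab adj cyc_succ_in_set by metis
      then show False using no_exchange ab y y' by blast
    qed
    then show ?thesis
      using cyc_succ_induct[of x0 v "\<lambda>x. \<exists>y\<in>set w. R x y"] x0 x by blast
  qed
  have "\<exists>y z. cyc_succ w y z \<and> R y x \<and> R x z" if x: "x \<in> set v" for x
  proof (rule ccontr)
    assume *: "\<not> ?thesis"
    obtain y where y: "y \<in> set w" "R y x" using inn x by blast
    have step: "R z x \<and> \<not> R x z" if "cyc_succ w y z" "R y x" for y z
      using * that adj x cyc_succ_in_set by metis
    \<comment> \<open>If \<open>x\<close> fits nowhere, domination of \<open>x\<close> spreads round
      \<open>w\<close> and leaves \<open>x\<close> without an out-neighbour there.\<close>
    have "R z x" if "z \<in> set w" for z
      using cyc_succ_induct[of y w "\<lambda>y. R y x"] y step that by blast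
    then have "\<not> R x z" if "z \<in> set w" for z
      using step ex_cyc_pred that cyc_succ_in_set by metis
    then show False using out x by blast
  qed
  then have "\<exists>u. closed_walk R u \<and> mset u = mset w + mset v"
    using v w by (intro insert_walk_into_closed_walk) (auto simp: closed_walk_def)
  then show False using contra by (auto simp: add.commute)
qed

text \<open>A degenerate exchange: both removed arcs end in \<open>x\<close>, so the arcs put in are
  the removed ones.\<close>

lemma merge_closed_walks_common_vertex:
  assumes "closed_walk R v" "closed_walk R w" "x \<in> set v" "x \<in> set w"
  shows "\<exists>u. closed_walk R u \<and> mset u = mset v + mset w"
proof -
  obtain y y' where "cyc_succ v y x" "cyc_succ w y' x" using assms ex_cyc_pred by metis
  moreover from this have "R y x" "R y' x" using assms cyc_succ_arc by metis+
  ultimately show ?thesis using merge_exchange assms by metis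
qed

lemma merge_closed_walk_triangle:
  assumes "closed_walk R u" "closed_walk R v" "closed_walk R w"
    and "\<And>x y. x \<in> set u \<Longrightarrow> y \<in> set v \<Longrightarrow> R x y"
    and "\<And>x y. x \<in> set v \<Longrightarrow> y \<in> set w \<Longrightarrow> R x y"
    and "\<And>x y. x \<in> set w \<Longrightarrow> y \<in> set u \<Longrightarrow> R x y"
  shows "closed_walk R (u @ v @ w)"
  using assms by (auto simp: closed_walk_def successively_append_iff)

text \<open>A multiset, because different cycles may project to the same walk of \<open>T\<close>.
  Induction on its size: replacing a mergeable subfamily by one walk keeps both the visited set
  \<open>U\<close> and the total of visits.\<close>

lemma merge_closed_walk_family:
  fixes F :: "'a list multiset"
  assumes "F \<noteq> {#}" and "\<And>w. w \<in># F \<Longrightarrow> closed_walk R w"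
    and U: "U = (\<Union>w\<in>set_mset F. set w)"
    and semi: "\<And>x y. \<lbrakk>x \<in> U; y \<in> U; x \<noteq> y\<rbrakk> \<Longrightarrow> R x y \<or> R y x"
    and strong: "\<And>X. \<lbrakk>X \<noteq> {}; X \<subset> U\<rbrakk> \<Longrightarrow> \<exists>x\<in>X. \<exists>y\<in>U - X. R x y"
  shows "\<exists>w. closed_walk R w \<and> mset w = (\<Sum>w\<in>#F. mset w)"
  using assms(1-3)
proof (induction "size F" arbitrary: F rule: less_induct)
  case (less F)
  note cw = less.prems(2) and U = less.prems(3)
  show ?case
  proof (rule ccontr)
    assume contra: "\<not> ?thesis"
    have irreducible: "\<not> (closed_walk R w \<and> mset w = (\<Sum>w\<in>#S. mset w))"
      if S: "S \<subseteq># F" "size S \<ge> 2" for S w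
    proof
      assume w: "closed_walk R w \<and> mset w = (\<Sum>w\<in>#S. mset w)"
      obtain G where G: "F = S + G" using S by (metis mset_subset_eq_exists_conv)
      have "set w = (\<Union>w\<in>set_mset S. set w)"
        using w by (simp flip: set_mset_mset)
      then have "U = (\<Union>w\<in>set_mset (add_mset w G). set w)" using U G by auto
      then have "\<exists>w'. closed_walk R w' \<and> mset w' = (\<Sum>w\<in>#add_mset w G. mset w)"
        using S w G cw by (intro less.hyps) auto
      then show False using contra w G by simp
    qed
    have pair: "\<not> (closed_walk R w \<and> mset w = mset u + mset v)" if "{#u, v#} \<subseteq># F" for u v w
      using irreducible[OF that, of w] by simp
    have dom: "set u \<inter> set v = {} \<and> (\<forall>x\<in>set u. \<forall>y\<in>set v. R x y \<or> R y x)
        \<and> ((\<forall>x\<in>set u. \<forall>y\<in>set v. \<not> R y x) \<or> (\<forall>x\<in>set u. \<forall>y\<in>set v. \<not> R x y))"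
      if uv: "{#u, v#} \<subseteq># F" for u v
    proof -
      have in_F: "u \<in># F" "v \<in># F" using uv by (auto simp: insert_subset_eq_iff dest: in_diffD)
      then have c: "closed_walk R u" "closed_walk R v" using cw by auto
      have disj: "set u \<inter> set v = {}"
        using merge_closed_walks_common_vertex[OF c] pair[OF uv] by blast
      have adj: "R x y \<or> R y x" if "x \<in> set u" "y \<in> set v" for x y
        using semi[of x y] that disj in_F U by blast
      show ?thesis
        using merge_closed_walks_or_dominate[OF c adj] pair[OF uv] disj adj by blast
    qed
    obtain w G where F: "F = add_mset w G" using less.prems(1) by (meson multiset_cases)
    have "G \<noteq> {#}"
    proof
      assume "G = {#}"
      then show False using contra cw F by auto
    qed
    have sub: "{#w, v#} \<subseteq># F" if "v \<in># G" for v using that F by simp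
    \<comment> \<open>The vertices on the out-neighbours of \<open>w\<close> in the tournament of
      walks. No arc leads from them to \<open>w\<close>, so an arc leaving this set ends on a walk
      that dominates \<open>w\<close>, which closes a triangle.\<close>
    define O' where "O' = (\<Union>v\<in>{v \<in> set_mset G. \<forall>x\<in>set w. \<forall>y\<in>set v. \<not> R y x}. set v)"
    have wU: "set w \<subseteq> U" and w0: "set w \<noteq> {}"
      using U F cw[of w] by (auto simp: closed_walk_def)
    obtain v where "v \<in># G" using \<open>G \<noteq> {#}\<close> by blast
    then have "set v \<inter> set w = {}" "set v \<noteq> {}" "set v \<subseteq> U"
      using dom[OF sub, of v] U F cw[of v] by (blast, auto simp: closed_walk_def)
    moreover from this have "hd v \<in> set v" by simp
    ultimately have "hd v \<in> U" "hd v \<notin> set w" by blast+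
    then have "set w \<subset> U" using wU by auto
    then obtain x y where xy: "x \<in> set w" "y \<in> U - set w" "R x y" using strong[OF w0] by blast
    then obtain v1 where v1: "v1 \<in># G" "y \<in> set v1" using U F by auto
    then have "v1 \<in> {v \<in> set_mset G. \<forall>x\<in>set w. \<forall>y\<in>set v. \<not> R y x}"
      using dom[OF sub[OF v1(1)]] xy by blast
    then have "O' \<noteq> {}" using v1 unfolding O'_def by blast
    moreover have "O' \<subset> U"
    proof -
      have "set w \<inter> set v = {}" if "v \<in># G" for v using dom[OF sub[OF that]] by blast
      then have "O' \<inter> set w = {}" by (auto simp: O'_def)
      moreover have "O' \<subseteq> U" unfolding U F O'_def by auto
      moreover have "hd w \<in> set w" using w0 by simp
      ultimately show ?thesis using wU by blast
    qed
    ultimately obtain a b where ab: "a \<in> O'" "b \<in> U - O'" "R a b" using strong[of O'] by blast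
    obtain v2 where v2: "v2 \<in># G" "a \<in> set v2" and nv2: "\<forall>x\<in>set w. \<forall>y\<in>set v2. \<not> R y x"
      using ab(1) unfolding O'_def by blast
    have "b \<notin> set w" using ab(3) nv2 v2(2) by blast
    moreover have "b \<in> U" using ab by simp
    ultimately obtain v3 where v3: "v3 \<in># G" "b \<in> set v3" unfolding U F by auto
    have nv3: "\<forall>x\<in>set w. \<forall>y\<in>set v3. \<not> R x y"
      using ab(2) v3 dom[OF sub[OF v3(1)]] unfolding O'_def by blast
    have "v3 \<noteq> v2" using ab(2) v2 v3 nv2 unfolding O'_def by blast
    obtain G' where G': "G = add_mset v2 G'" using multi_member_split[OF v2(1)] by blast
    then have "v3 \<in># G'" using v3(1) \<open>v3 \<noteq> v2\<close> by simp
    then have s: "{#v2, v3#} \<subseteq># G" by (simp add: G')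
    have "G \<subseteq># F" by (simp add: F)
    with s have s2: "{#v2, v3#} \<subseteq># F" by (rule subset_mset.order_trans)
    have s3: "{#w, v2, v3#} \<subseteq># F" using s unfolding F by (simp only: mset_subset_eq_add_mset_cancel)
    have "closed_walk R (w @ v2 @ v3)"
    proof (rule merge_closed_walk_triangle)
      show "closed_walk R w" "closed_walk R v2" "closed_walk R v3" using cw F v2 v3 by auto
      show "R x y" if "x \<in> set w" "y \<in> set v2" for x y
        using dom[OF sub[OF v2(1)]] nv2 that by blast
      show "R x y" if "x \<in> set v2" "y \<in> set v3" for x y
        using dom[OF s2] ab v2 v3 that by blast
      show "R x y" if "x \<in> set v3" "y \<in> set w" for x y
        using dom[OF sub[OF v3(1)]] nv3 that by blast
    qed
    then show False using irreducible[OF s3, of "w @ v2 @ v3"] by simp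
  qed
qed

section \<open>Permutations and families of closed walks\<close>

text \<open>The product of the rotations of the cycles; disjoint supports make it act on each cycle
  as the rotation of that cycle.\<close>

lemma ex_permutation_of_cycle_family:
  assumes "finite C" and "\<And>c. c \<in> C \<Longrightarrow> distinct c"
    and "\<And>c d. \<lbrakk>c \<in> C; d \<in> C; c \<noteq> d\<rbrakk> \<Longrightarrow> set c \<inter> set d = {}"
  shows "\<exists>f. f permutes (\<Union>c\<in>C. set c) \<and> (\<forall>c\<in>C. map f c = rotate1 c)"
  using assms
proof (induction C rule: finite_induct)
  case empty
  then show ?case by auto
next
  case (insert c C)
  then obtain f where f: "f permutes (\<Union>c\<in>C. set c)" "\<forall>c\<in>C. map f c = rotate1 c"
    by (metis insert_iff)
  have disj: "set c \<inter> set d = {}" if "d \<in> C" for d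
    using insert.prems(2)[of c d] insert.hyps that by auto
  define g where "g = cycle_of_list c \<circ> f"
  have "cycle_of_list c permutes (\<Union>c\<in>insert c C. set c)"
    using cycle_permutes by (rule permutes_subset) auto
  moreover have "f permutes (\<Union>c\<in>insert c C. set c)"
    using f(1) by (rule permutes_subset) auto
  ultimately have "g permutes (\<Union>c\<in>insert c C. set c)"
    unfolding g_def by (rule permutes_compose[rotated])
  moreover have "map g c = rotate1 c"
  proof -
    have "f x = x" if "x \<in> set c" for x
      using f(1) disj that by (intro permutes_not_in[OF f(1)]) auto
    then have "map g c = map (cycle_of_list c) c" by (auto simp: g_def)
    also have "\<dots> = rotate1 c" using cyclic_rotation[of c 1] insert.prems(1)[of c] by simp
    finally show ?thesis .
  qed
  moreover have "map g d = rotate1 d" if d: "d \<in> C" for d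
  proof -
    have "f x \<in> set d" if "x \<in> set d" for x
      using f(2) d that by (metis image_eqI list.set_map set_rotate1)
    then have "map g d = map f d"
      using disj[OF d] by (auto simp: g_def intro!: id_outside_supp)
    then show ?thesis using f(2) d by simp
  qed
  ultimately show ?case by auto
qed

text \<open>Fixed points occur as one-element lists, so the lists partition all of
  \<open>V\<close>.\<close>

lemma ex_cycle_family_of_permutation:
  assumes "f permutes V" "finite V"
  shows "\<exists>F. (\<forall>w\<in>#F. w \<noteq> [] \<and> set w \<subseteq> V \<and> map f w = rotate1 w) \<and> (\<Sum>w\<in>#F. mset w) = mset_set V"
  using cycle_decomposition[OF assms]
proof (induction rule: cycle_decomp.induct)
  case empty
  then show ?case by (intro exI[of _ "{#}"]) auto
next
  case (comp I p cs)
  \<comment> \<open>The induction hypothesis speaks of lists only; that \<open>p\<close> permutes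
    \<open>I\<close> takes an induction of its own.\<close>
  have fin: "finite I \<and> p permutes I" using comp(1)
  proof (induction rule: cycle_decomp.induct)
    case (comp I p cs)
    have "cycle_of_list cs permutes (set cs \<union> I)" "p permutes (set cs \<union> I)"
      using comp.IH cycle_permutes[of cs] by (auto intro: permutes_subset)
    then have "cycle_of_list cs \<circ> p permutes set cs \<union> I"
      using permutes_compose by blast
    then show ?case using comp.IH by (simp del: o_apply)
  qed auto
  obtain F where F: "\<forall>w\<in>#F. w \<noteq> [] \<and> set w \<subseteq> I \<and> map p w = rotate1 w"
    "(\<Sum>w\<in>#F. mset w) = mset_set I" using comp.IH by blast
  define q where "q = cycle_of_list cs \<circ> p"
  have old: "map q w = rotate1 w" if "w \<in># F" for w
  proof -
    have "set w \<subseteq> I" "map p w = rotate1 w" using F(1) that by auto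
    moreover from this have "p x \<in> I" if "x \<in> set w" for x
      using that fin by (auto simp: permutes_in_image)
    ultimately have "cycle_of_list cs (p x) = p x" if "x \<in> set w" for x
      using comp(3) that by (intro id_outside_supp) auto
    then have "map q w = map p w" by (intro map_cong) (auto simp: q_def)
    then show ?thesis using F(1) that by simp
  qed
  have "\<exists>F. (\<forall>w\<in>#F. w \<noteq> [] \<and> set w \<subseteq> set cs \<union> I \<and> map q w = rotate1 w)
      \<and> (\<Sum>w\<in>#F. mset w) = mset_set (set cs \<union> I)"
  proof (cases "cs = []")
    case True
    then show ?thesis using F old by (intro exI[of _ F]) auto
  next
    case False
    have "p x = x" if "x \<in> set cs" for x
      using fin comp(3) that by (intro permutes_not_in[of p I]) auto
    then have "map q cs = map (cycle_of_list cs) cs" by (auto simp: q_def)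
    also have "\<dots> = rotate1 cs" using cyclic_rotation[of cs 1] comp(2) by simp
    finally have "map q cs = rotate1 cs" .
    moreover have "mset_set (set cs \<union> I) = mset cs + mset_set I"
      using comp(2,3) fin by (simp add: mset_set_Union mset_set_set)
    ultimately show ?thesis
      using F old False by (intro exI[of _ "add_mset cs F"]) auto
  qed
  then show ?case unfolding q_def .
qed

lemma ex_list_of_trancl:
  assumes "(u, v) \<in> A\<^sup>+"
  shows "\<exists>w. w \<noteq> [] \<and> hd w = u \<and> successively (\<lambda>x y. (x, y) \<in> A) w \<and> (last w, v) \<in> A"
  using assms
proof (induction rule: trancl_induct)
  case (base y)
  then show ?case by (intro exI[of _ "[u]"]) auto
next
  case (step y z)
  then obtain w where "w \<noteq> []" "hd w = u" "successively (\<lambda>x y. (x, y) \<in> A) w" "(last w, y) \<in> A"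
    by blast
  then show ?case using step by (intro exI[of _ "w @ [y]"]) (auto simp: successively_append_iff)
qed

text \<open>At a repeated vertex a closed walk splits into two shorter ones, and \<open>x\<close>
  survives on one of them.\<close>

lemma ex_distinct_closed_walk:
  assumes "closed_walk R w" "x \<in> set w"
  shows "\<exists>w'. closed_walk R w' \<and> distinct w' \<and> x \<in> set w'"
  using assms
proof (induction w rule: length_induct)
  case (1 w)
  show ?case
  proof (cases "distinct w")
    case False
    then obtain xs ys zs y where w: "w = xs @ [y] @ ys @ [y] @ zs"
      using not_distinct_decomp by blast
    have s: "successively R (xs @ [y])" "successively R (y # ys)" "successively R (y # zs)"
      "R (last (y # ys)) y" "R (last (y # zs)) (hd (xs @ [y]))"
      using "1.prems"(1) unfolding w closed_walk_def
      by (auto simp: successively_append_iff successively_Cons hd_append split: if_splits)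
    have "closed_walk R (y # ys)" using s by (auto simp: closed_walk_def)
    moreover have "closed_walk R (xs @ y # zs)"
      using s unfolding closed_walk_def
      by (auto simp: successively_append_iff hd_append split: if_splits)
    moreover have "x \<in> set (y # ys) \<or> x \<in> set (xs @ y # zs)" using "1.prems"(2) w by auto
    ultimately show ?thesis
      using "1.IH"[rule_format, of "y # ys"] "1.IH"[rule_format, of "xs @ y # zs"] w by auto
  qed (use 1 in blast)
qed

section \<open>Compositions\<close>

abbreviation arc :: "'a digraph \<Rightarrow> 'a \<Rightarrow> 'a \<Rightarrow> bool" where
  "arc G \<equiv> \<lambda>x y. (x, y) \<in> arcs G"

abbreviation independent_composition :: "'a digraph \<Rightarrow> ('a \<Rightarrow> 'b digraph) \<Rightarrow> ('a \<times> 'b) digraph" where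
  "independent_composition T H \<equiv> composition T (\<lambda>v. empty_digraph (verts (H v)))"

lemma is_path_iff:
  "is_path G p \<longleftrightarrow> p \<noteq> [] \<and> distinct p \<and> set p \<subseteq> verts G \<and> successively (arc G) p"
  by (simp add: is_path_def successively_conv_nth)

lemma is_cycle_iff: "is_cycle G c \<longleftrightarrow> distinct c \<and> set c \<subseteq> verts G \<and> closed_walk (arc G) c"
  by (auto simp: is_cycle_def is_path_iff closed_walk_def)

lemma verts_composition: "verts (composition T H) = (SIGMA u:verts T. verts (H u))"
  by (auto simp: composition_def verts_def)

lemma arcs_composition:
  "((u, x), (v, y)) \<in> arcs (composition T H) \<longleftrightarrow> u \<in> verts T \<and> v \<in> verts T
     \<and> x \<in> verts (H u) \<and> y \<in> verts (H v) \<and> ((u = v \<and> (x, y) \<in> arcs (H u)) \<or> (u, v) \<in> arcs T)"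
  by (auto simp: composition_def arcs_def)

lemma verts_empty_digraph [simp]: "verts (empty_digraph X) = X"
  and arcs_empty_digraph [simp]: "arcs (empty_digraph X) = {}"
  by (auto simp: empty_digraph_def verts_def arcs_def)

lemma wf_digraph_irrefl: "wf_digraph G \<Longrightarrow> (v, v) \<notin> arcs G"
  by (simp add: wf_digraph_def)

lemma wf_digraph_arcD: "wf_digraph G \<Longrightarrow> (u, v) \<in> arcs G \<Longrightarrow> u \<in> verts G \<and> v \<in> verts G"
  by (auto simp: wf_digraph_def)

lemma closed_walk_set_verts:
  assumes "wf_digraph G" "closed_walk (arc G) w"
  shows "set w \<subseteq> verts G"
  using assms ex_cyc_succ cyc_succ_arc wf_digraph_arcD by (metis subsetI)

section \<open>Visits of \<open>T\<close> expanded into paths, and cycles of the composition cut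
  into runs\<close>

definition expand :: "('a \<times> 'b list) list \<Rightarrow> ('a \<times> 'b) list" where
  "expand zs = concat (map (\<lambda>(u, p). map (Pair u) p) zs)"

lemma expand_simps [simp]:
  "expand [] = []" "expand ((u, p) # zs) = map (Pair u) p @ expand zs"
  by (auto simp: expand_def)

lemma set_expand: "set (expand zs) = (\<Union>(u, p)\<in>set zs. Pair u ` set p)"
  by (auto simp: expand_def)

lemma hd_last_concat:
  assumes "xss \<noteq> []" "[] \<notin> set xss"
  shows "hd (concat xss) = hd (hd xss)" "last (concat xss) = last (last xss)"
proof -
  have "hd (concat xss) = hd (hd xss) \<and> last (concat xss) = last (last xss) \<and> concat xss \<noteq> []"
    using assms
  proof (induction xss)
    case (Cons xs xss)
    then show ?case by (cases "xss = []") (auto simp add: hd_append last_append simp del: concat_eq_Nil_conv)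
  qed simp
  then show "hd (concat xss) = hd (hd xss)" "last (concat xss) = last (last xss)" by simp_all
qed

lemma successively_concat:
  assumes "[] \<notin> set xss"
  shows "successively R (concat xss) \<longleftrightarrow>
    (\<forall>xs\<in>set xss. successively R xs) \<and> successively (\<lambda>xs ys. R (last xs) (hd ys)) xss"
  using assms
proof (induction xss)
  case (Cons xs xss)
  show ?case
  proof (cases "xss = []")
    case False
    then have "concat xss \<noteq> []" using Cons.prems by (cases xss) auto
    then show ?thesis
      using Cons False hd_last_concat(1)[of xss]
      by (simp add: successively_append_iff successively_Cons del: concat_eq_Nil_conv) blast
  qed simp
qed simp

lemma closed_walk_concat:
  assumes "xss \<noteq> []" "[] \<notin> set xss"
  shows "closed_walk R (concat xss) \<longleftrightarrow>
    (\<forall>xs\<in>set xss. successively R xs) \<and> closed_walk (\<lambda>xs ys. R (last xs) (hd ys)) xss"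
proof -
  have "concat xss \<noteq> []" using assms by (cases xss) auto
  then show ?thesis
    using hd_last_concat[OF assms] successively_concat[OF assms(2), of R] assms(1)
    by (auto simp: closed_walk_def)
qed

lemma closed_walk_cong_set:
  assumes "closed_walk R w" "\<And>x y. \<lbrakk>x \<in> set w; y \<in> set w; R x y\<rbrakk> \<Longrightarrow> S x y"
  shows "closed_walk S w"
  using assms unfolding closed_walk_iff_rotate1 by (fastforce dest: set_zip_leftD set_zip_rightD)

lemma closed_walk_expand:
  assumes ne: "zs \<noteq> []" "\<And>u p. (u, p) \<in> set zs \<Longrightarrow> p \<noteq> []"
  shows "closed_walk R (expand zs) \<longleftrightarrow>
    (\<forall>(u, p)\<in>set zs. successively (\<lambda>x y. R (u, x) (u, y)) p) \<and>
    closed_walk (\<lambda>(u, p) (v, q). R (u, last p) (v, hd q)) zs"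
proof -
  let ?e = "\<lambda>(u, p). map (Pair u) p"
  have "[] \<notin> set (map ?e zs)" using ne(2) by fastforce
  then have "closed_walk R (expand zs) \<longleftrightarrow>
      (\<forall>xs\<in>set (map ?e zs). successively R xs) \<and>
      closed_walk (\<lambda>x y. R (last (?e x)) (hd (?e y))) zs"
    unfolding expand_def using ne(1) by (subst closed_walk_concat) (auto simp: closed_walk_map)
  also have "(\<forall>xs\<in>set (map ?e zs). successively R xs)
      \<longleftrightarrow> (\<forall>(u, p)\<in>set zs. successively (\<lambda>x y. R (u, x) (u, y)) p)"
    by (auto simp: successively_map split_beta)
  also have "closed_walk (\<lambda>x y. R (last (?e x)) (hd (?e y))) zs
      \<longleftrightarrow> closed_walk (\<lambda>(u, p) (v, q). R (u, last p) (v, hd q)) zs"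
    by (intro iffI; erule closed_walk_cong_set) (auto simp: last_map hd_map ne(2))
  finally show ?thesis .
qed

text \<open>Deals out the members of \<open>P u\<close> to the occurrences of \<open>u\<close> in
  \<open>w\<close>; equal numbers leave none over.\<close>

lemma ex_list_of_choices:
  assumes "\<And>u. finite (P u)" "\<And>u. card (P u) = count (mset w) u"
  shows "\<exists>zs. map fst zs = w \<and> distinct zs \<and> set zs = (SIGMA u:UNIV. P u)"
  using assms
proof (induction w arbitrary: P)
  case Nil
  then show ?case by (auto simp: Sigma_def)
next
  case (Cons u w)
  have "card (P u) > 0" using Cons.prems(2)[of u] by simp
  then obtain p where p: "p \<in> P u" by (metis card_gt_0_iff ex_in_conv)
  define P' where "P' = P(u := P u - {p})"
  have "\<exists>zs. map fst zs = w \<and> distinct zs \<and> set zs = (SIGMA u:UNIV. P' u)"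
  proof (rule Cons.IH)
    show "finite (P' v)" for v using Cons.prems(1) by (auto simp: P'_def)
    show "card (P' v) = count (mset w) v" for v
      using Cons.prems(2)[of v] p by (auto simp: P'_def)
  qed
  then obtain zs where "map fst zs = w" "distinct zs" "set zs = (SIGMA u:UNIV. P' u)" by blast
  then show ?case
    using p by (intro exI[of _ "(u, p) # zs"]) (auto simp: P'_def split: if_splits)
qed

text \<open>Blocks joined in \<open>T\<close> are joined completely, so any path of one block can be
  followed by any path of the next: the paths may be dealt out to the visits in any order.\<close>

lemma substitute_paths_in_closed_walk:
  assumes T: "wf_digraph T" and w: "closed_walk (arc T) w"
    and P: "\<And>u. finite (P u)" "\<And>u. card (P u) = count (mset w) u"
    and path: "\<And>u p. p \<in> P u \<Longrightarrow> is_path (H u) p"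
    and disj: "\<And>u p q. \<lbrakk>p \<in> P u; q \<in> P u; p \<noteq> q\<rbrakk> \<Longrightarrow> set p \<inter> set q = {}"
  shows "\<exists>c. is_cycle (composition T H) c \<and> set c = (SIGMA u:UNIV. \<Union>p\<in>P u. set p)"
proof -
  obtain zs where zs: "map fst zs = w" "distinct zs" "set zs = (SIGMA u:UNIV. P u)"
    using ex_list_of_choices[OF P] by blast
  let ?e = "\<lambda>(u, p). map (Pair u) p"
  have T': "u \<in> verts T" if "(u, p) \<in> set zs" for u p
    using closed_walk_set_verts[OF T w] zs(1) that by force
  have pth: "is_path (H u) p" if "(u, p) \<in> set zs" for u p using that zs(3) path by auto
  then have ne: "p \<noteq> []" if "(u, p) \<in> set zs" for u p using that by (auto simp: is_path_iff)
  have setc: "set (expand zs) = (SIGMA u:UNIV. \<Union>p\<in>P u. set p)"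
    by (auto simp: set_expand zs(3))
  have "distinct (expand zs)" unfolding expand_def
  proof (rule distinct_concat)
    \<comment> \<open>A nonempty list of pairs shows its block, so distinct entries of
      \<open>zs\<close> expand to distinct lists.\<close>
    have "inj_on ?e (set zs)"
    proof (rule inj_onI)
      fix a b assume ab: "a \<in> set zs" "b \<in> set zs" "?e a = ?e b"
      obtain u p v q where [simp]: "a = (u, p)" "b = (v, q)" by fastforce
      have "p \<noteq> []" "q \<noteq> []" using ne ab by auto
      then have "u = v" using ab(3) by (cases p; cases q) auto
      then show "a = b" using ab(3) by (auto simp: inj_map_eq_map inj_def)
    qed
    then show "distinct (map ?e zs)" using zs(2) by (simp add: distinct_map)
  next
    fix ys assume "ys \<in> set (map ?e zs)"
    then obtain u p where "(u, p) \<in> set zs" "ys = map (Pair u) p" by auto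
    then show "distinct ys" using pth by (auto simp: is_path_iff distinct_map inj_on_def)
  next
    fix ys ys' assume "ys \<in> set (map ?e zs)" "ys' \<in> set (map ?e zs)" and neq: "ys \<noteq> ys'"
    then obtain u p v q where *: "(u, p) \<in> set zs" "ys = map (Pair u) p"
      "(v, q) \<in> set zs" "ys' = map (Pair v) q" by fastforce
    show "set ys \<inter> set ys' = {}"
    proof (cases "u = v")
      case True
      then have "set p \<inter> set q = {}" using * neq zs(3) by (intro disj[of p u q]) auto
      then show ?thesis using * by auto
    qed (use * in auto)
  qed
  moreover have "set (expand zs) \<subseteq> verts (composition T H)"
    using T' pth by (fastforce simp: set_expand verts_composition is_path_iff)
  moreover have "closed_walk (arc (composition T H)) (expand zs)"
  proof (subst closed_walk_expand)
    show "zs \<noteq> []" using w zs(1) by (auto simp: closed_walk_def)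
    have "successively (\<lambda>x y. arc (composition T H) (u, x) (u, y)) p" if z: "(u, p) \<in> set zs" for u p
    proof (rule successively_mono)
      show "successively (arc (H u)) p" using pth z by (auto simp: is_path_iff)
      show "arc (composition T H) (u, x) (u, y)" if "x \<in> set p" "y \<in> set p" "arc (H u) x y" for x y
        using that pth[OF z] T'[OF z] by (auto simp: arcs_composition is_path_iff)
    qed
    moreover have "closed_walk (\<lambda>(u, p) (v, q). arc (composition T H) (u, last p) (v, hd q)) zs"
    proof (rule closed_walk_cong_set)
      show "closed_walk (\<lambda>x y. arc T (fst x) (fst y)) zs"
        using w zs(1) closed_walk_map[of "arc T" fst zs] by simp
      fix x y assume xy: "x \<in> set zs" "y \<in> set zs" "arc T (fst x) (fst y)"
      obtain u p v q where [simp]: "x = (u, p)" "y = (v, q)" by fastforce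
      have "last p \<in> verts (H u)" "hd q \<in> verts (H v)"
        using pth xy by (auto simp: is_path_iff subset_iff)
      then show "(case x of (u, p) \<Rightarrow> \<lambda>(v, q). arc (composition T H) (u, last p) (v, hd q)) y"
        using T' xy by (auto simp: arcs_composition)
    qed
    ultimately show "(\<forall>(u, p)\<in>set zs. successively (\<lambda>x y. arc (composition T H) (u, x) (u, y)) p) \<and>
      closed_walk (\<lambda>(u, p) (v, q). arc (composition T H) (u, last p) (v, hd q)) zs" by blast
  qed (use ne in auto)
  ultimately show ?thesis using setc by (auto simp: is_cycle_iff)
qed

text \<open>Consecutive entries from different blocks make the runs maximal, so that in a
  composition the arcs joining runs come from \<open>T\<close>.\<close>

lemma ex_runs:
  "\<exists>zs. c = expand zs \<and> (\<forall>(u, p)\<in>set zs. p \<noteq> []) \<and> successively (\<lambda>y z. fst y \<noteq> fst z) zs"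
proof (induction c)
  case Nil
  then show ?case by (intro exI[of _ "[]"]) auto
next
  case (Cons a c)
  obtain u x where [simp]: "a = (u, x)" by fastforce
  obtain zs where zs: "c = expand zs" "\<forall>(u, p)\<in>set zs. p \<noteq> []"
    "successively (\<lambda>y z. fst y \<noteq> fst z) zs" using Cons.IH by blast
  show ?case
  proof (cases zs)
    case Nil
    then show ?thesis using zs by (intro exI[of _ "[(u, [x])]"]) auto
  next
    case zs': (Cons b zs')
    obtain v q where [simp]: "b = (v, q)" by fastforce
    show ?thesis
    proof (cases "v = u")
      case True
      then show ?thesis using zs zs'
        by (intro exI[of _ "(u, x # q) # zs'"]) (auto simp: successively_Cons)
    next
      case False
      then show ?thesis using zs zs'
        by (intro exI[of _ "(u, [x]) # zs"]) (auto simp: successively_Cons)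
    qed
  qed
qed

lemma distinct_expand_disjoint:
  assumes "distinct (expand zs)" "(u, p) \<in> set zs" "(u, q) \<in> set zs" "p \<noteq> q"
  shows "set p \<inter> set q = {}"
  using assms
proof (induction zs)
  case (Cons a zs)
  obtain v r where a: "a = (v, r)" by fastforce
  have "Pair v ` set r \<inter> Pair u ` set s = {}" if "(u, s) \<in> set zs" for s
    using Cons.prems(1) that unfolding a by (fastforce simp: set_expand)
  then have disj: "set r \<inter> set s = {}" if "(u, s) \<in> set zs" "v = u" for s
    using that by (fastforce simp: disjoint_iff)
  consider "(u, p) \<in> set zs" "(u, q) \<in> set zs" | "(u, p) = a" "(u, q) \<in> set zs"
    | "(u, q) = a" "(u, p) \<in> set zs" using Cons.prems by auto
  then show ?case
  proof cases
    case 1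
    then show ?thesis using Cons a by simp
  next
    case 2
    then have "v = u" "r = p" using a by simp_all
    then show ?thesis using disj[of q] 2 by simp
  next
    case 3
    then have "v = u" "r = q" using a by simp_all
    then show ?thesis using disj[of p] 3 by (simp add: Int_commute)
  qed
qed simp

text \<open>A cycle not confined to a block has an arc that changes blocks; rotated so that this arc
  closes the list, no run wraps around the end. As \<open>T\<close> has no loops, arcs within a run
  belong to \<open>H u\<close> and arcs between runs to \<open>T\<close>.\<close>

lemma cycle_runs:
  assumes T: "wf_digraph T" and c: "is_cycle (composition T H) c" and nonconst: "\<nexists>u. fst ` set c \<subseteq> {u}"
  shows "\<exists>zs. distinct (expand zs) \<and> set (expand zs) = set c \<and> (\<forall>(u, p)\<in>set zs. is_path (H u) p)
    \<and> closed_walk (\<lambda>x y. arc T (fst x) (fst y)) zs"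
proof -
  have cw: "closed_walk (arc (composition T H)) c" using c by (simp add: is_cycle_iff)
  have "\<exists>y z. cyc_succ c y z \<and> fst y \<noteq> fst z"
  proof (rule ccontr)
    assume *: "\<not> ?thesis"
    have "hd c \<in> set c" using cw by (auto simp: closed_walk_def)
    then have "fst z = fst (hd c)" if "z \<in> set c" for z
      using cyc_succ_induct[of "hd c" c "\<lambda>z. fst z = fst (hd c)" z] that * by metis
    then show False using nonconst by auto
  qed
  then obtain n where n: "fst (last (rotate n c)) \<noteq> fst (hd (rotate n c))"
    by (metis cyc_succ_rotation)
  obtain zs where zs: "rotate n c = expand zs" "\<forall>(u, p)\<in>set zs. p \<noteq> []"
    "successively (\<lambda>y z. fst y \<noteq> fst z) zs"
    using ex_runs[of "rotate n c"] by (elim exE conjE)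
  have zs0: "zs \<noteq> []" using zs(1) cw by (auto simp: closed_walk_def)
  have ne: "p \<noteq> []" if "(u, p) \<in> set zs" for u p using zs(2) that by auto
  have "[] \<notin> set (map (\<lambda>(u, p). map (Pair u) p) zs)" using ne by fastforce
  note hd_last_concat[OF _ this]
  moreover have "snd (hd zs) \<noteq> []" "snd (last zs) \<noteq> []"
    using ne hd_in_set[OF zs0] last_in_set[OF zs0] by (metis prod.collapse)+
  ultimately have "fst (last (expand zs)) = fst (last zs)" "fst (hd (expand zs)) = fst (hd zs)"
    using zs0 by (simp_all add: expand_def last_map hd_map split_beta)
  then have alt: "closed_walk (\<lambda>y z. fst y \<noteq> fst z) zs"
    using zs(1,3) zs0 n by (simp add: closed_walk_def)
  have cwe: "closed_walk (arc (composition T H)) (expand zs)"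
    using closed_walk_rotate[OF cw] zs(1) by metis
  have succ: "\<forall>(u, p)\<in>set zs. successively (\<lambda>x y. arc (composition T H) (u, x) (u, y)) p"
    and cw2: "closed_walk (\<lambda>(u, p) (v, q). arc (composition T H) (u, last p) (v, hd q)) zs"
    using cwe closed_walk_expand[OF zs0 ne, where R = "arc (composition T H)"] by auto
  have dist: "distinct (expand zs)" and set: "set (expand zs) = set c"
    using c zs(1) by (simp_all add: is_cycle_iff flip: zs(1))
  have "is_path (H u) p" if up: "(u, p) \<in> set zs" for u p
  proof -
    have "distinct p" using dist up by (induction zs) (auto simp: distinct_map)
    moreover have "Pair u ` set p \<subseteq> verts (composition T H)"
      using c set up by (fastforce simp: is_cycle_iff set_expand)
    then have "set p \<subseteq> verts (H u)" by (auto simp: verts_composition)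
    moreover have "successively (arc (H u)) p"
    proof (rule successively_mono)
      show "successively (\<lambda>x y. arc (composition T H) (u, x) (u, y)) p" using succ up by auto
    qed (use wf_digraph_irrefl[OF T] in \<open>auto simp: arcs_composition\<close>)
    ultimately show ?thesis using ne[OF up] by (simp add: is_path_iff)
  qed
  moreover have "closed_walk (\<lambda>x y. arc T (fst x) (fst y)) zs"
    using cw2 alt unfolding closed_walk_iff_rotate1
    by (fastforce simp: arcs_composition)
  ultimately show ?thesis using dist set by auto
qed

section \<open>Cuts and cycles of \<open>T\<close>\<close>

lemma successively_crossing:
  assumes "successively R p" "p \<noteq> []" "P (hd p)" "\<not> P (last p)"
  shows "\<exists>x y. R x y \<and> P x \<and> \<not> P y"
  using assms
proof (induction p)
  case (Cons a p)
  then show ?case by (cases "p = []"; cases "P (hd p)") (auto simp: successively_Cons)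
qed simp

text \<open>Strong connectivity enters through cuts: a path from a block in \<open>X\<close> to a
  block outside contains an arc leaving \<open>X\<close>, which changes the block and so comes from
  \<open>T\<close>.\<close>

lemma strong_composition_leaving_arc:
  assumes strong: "strong (composition T H)" and H: "\<forall>u\<in>verts T. verts (H u) \<noteq> {}"
    and X: "X \<noteq> {}" "X \<subset> verts T"
  shows "\<exists>u\<in>X. \<exists>v\<in>verts T - X. arc T u v"
proof -
  obtain u v where uv: "u \<in> X" "v \<in> verts T - X" using X by blast
  then obtain x y where xy: "x \<in> verts (H u)" "y \<in> verts (H v)" using H X by blast
  then have "(u, x) \<in> verts (composition T H)" "(v, y) \<in> verts (composition T H)"
    using uv X by (auto simp: verts_composition)
  then obtain p where p: "is_path (composition T H) p" "hd p = (u, x)" "last p = (v, y)"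
    using strong unfolding strong_def by meson
  have "\<exists>a b. arc (composition T H) a b \<and> fst a \<in> X \<and> \<not> fst b \<in> X"
    by (rule successively_crossing[of _ p]) (use p uv in \<open>auto simp: is_path_iff\<close>)
  then show ?thesis by (auto simp: arcs_composition)
qed

text \<open>If the vertices reached from \<open>u\<close> by nonempty walks missed \<open>u\<close>,
  they would form a cut without a leaving arc. The cycle serves to show that every m_i is
  positive.\<close>

lemma ex_distinct_closed_walk_through:
  assumes T: "wf_digraph T" and u: "u \<in> verts T" "verts T \<noteq> {u}"
    and leaving: "\<And>X. \<lbrakk>X \<noteq> {}; X \<subset> verts T\<rbrakk> \<Longrightarrow> \<exists>u\<in>X. \<exists>v\<in>verts T - X. arc T u v"
  shows "\<exists>w. closed_walk (arc T) w \<and> distinct w \<and> u \<in> set w"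
proof -
  have "(u, u) \<in> (arcs T)\<^sup>+"
  proof (rule ccontr)
    assume *: "(u, u) \<notin> (arcs T)\<^sup>+"
    define X where "X = {v. (u, v) \<in> (arcs T)\<^sup>+}"
    have sub: "X \<subseteq> verts T"
    proof
      fix v assume "v \<in> X"
      then have "(u, v) \<in> (arcs T)\<^sup>+" by (simp add: X_def)
      then show "v \<in> verts T" by (induction rule: trancl_induct) (auto dest: wf_digraph_arcD[OF T])
    qed
    obtain v where "v \<in> verts T" "arc T u v" using leaving[of "{u}"] u by auto
    then have "X \<noteq> {}" by (auto simp: X_def)
    moreover have "X \<subset> verts T" using sub u(1) * by (auto simp: X_def)
    ultimately obtain a b where "a \<in> X" "b \<notin> X" "arc T a b" using leaving[of X] by blast
    then show False by (auto simp: X_def intro: trancl_into_trancl)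
  qed
  then obtain w where "w \<noteq> []" "hd w = u" "successively (arc T) w" "arc T (last w) u"
    using ex_list_of_trancl by metis
  then have "closed_walk (arc T) w" "u \<in> set w" by (auto simp: closed_walk_def)
  then show ?thesis by (rule ex_distinct_closed_walk)
qed

section \<open>Simultaneous maximization of the block sizes\<close>

lemma cycle_subdigraph_iff:
  "cycle_subdigraph G C \<longleftrightarrow> finite C \<and> (\<forall>c\<in>C. is_cycle G c) \<and>
     (\<forall>c\<in>C. \<forall>d\<in>C. c \<noteq> d \<longrightarrow> set c \<inter> set d = {})"
  by (auto simp: cycle_subdigraph_def path_cycle_sub_def)

text \<open>Cycles of the independent composition follow arcs of \<open>T\<close>, which has no
  loops, so every covered vertex is moved.\<close>

lemma loopy_factor_of_cycle_subdigraph: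
  assumes T: "wf_digraph T" and C: "cycle_subdigraph (independent_composition T H) C"
  shows "\<exists>g. loopy_factor (SIGMA u:verts T. verts (H u)) fst (arc T) g
    \<and> {x. g x \<noteq> x} = (\<Union>c\<in>C. set c)"
proof -
  let ?K = "independent_composition T H"
  have cyc: "is_cycle ?K c" if "c \<in> C" for c using C that by (auto simp: cycle_subdigraph_iff)
  obtain g where g: "g permutes (\<Union>c\<in>C. set c)" "\<forall>c\<in>C. map g c = rotate1 c"
    using ex_permutation_of_cycle_family[of C] C cyc
    by (auto simp: cycle_subdigraph_iff is_cycle_iff)
  have arcs: "arc T (fst x) (fst (g x))" if x: "c \<in> C" "x \<in> set c" for c x
  proof -
    have "closed_walk (arc ?K) c" "map g c = rotate1 c" using cyc g x by (auto simp: is_cycle_iff)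
    then have "arc ?K x (g x)" using x closed_walk_iff_succ_map[of g c "arc ?K"] by blast
    then show ?thesis by (cases x; cases "g x") (simp add: arcs_composition)
  qed
  have "g x \<noteq> x" if "c \<in> C" "x \<in> set c" for c x
    using arcs[OF that] wf_digraph_irrefl[OF T] by metis
  moreover have fix_out: "g x = x" if "x \<notin> (\<Union>c\<in>C. set c)" for x
    using g(1) that by (rule permutes_not_in)
  ultimately have "{x. g x \<noteq> x} = (\<Union>c\<in>C. set c)" by blast
  moreover have "g permutes (SIGMA u:verts T. verts (H u))"
    using g(1) by (rule permutes_subset) (use cyc in \<open>auto simp: is_cycle_iff verts_composition\<close>)
  ultimately show ?thesis using arcs fix_out unfolding loopy_factor_def by blast
qed

text \<open>Makes the \<open>Max\<close> usable: the block size bounds the values, and the empty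
  family supplies one.\<close>

lemma m_val_greatest:
  fixes C :: "('a \<times> 'b) list set"
  assumes "finite (verts (H u))"
  shows "cycle_subdigraph (independent_composition T H) C
      \<Longrightarrow> card ((\<Union>c\<in>C. set c) \<inter> ({u} \<times> verts (H u))) \<le> m_val T H u"
    and "\<exists>C. cycle_subdigraph (independent_composition T H) C
      \<and> m_val T H u = card ((\<Union>c\<in>C. set c) \<inter> ({u} \<times> verts (H u)))"
proof -
  define S where "S = {card ((\<Union>c\<in>C. set c) \<inter> ({u} \<times> verts (H u))) | C.
      cycle_subdigraph (independent_composition T H) C}"
  have m: "m_val T H u = Max S" by (simp add: m_val_def S_def)
  have "S \<subseteq> {..card ({u} \<times> verts (H u))}"
  proof
    fix n assume "n \<in> S"
    then obtain C :: "('a \<times> 'b) list set"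
      where "n = card ((\<Union>c\<in>C. set c) \<inter> ({u} \<times> verts (H u)))" by (auto simp: S_def)
    then show "n \<in> {..card ({u} \<times> verts (H u))}"
      using card_mono[of "{u} \<times> verts (H u)" "(\<Union>c\<in>C. set c) \<inter> ({u} \<times> verts (H u))"] assms by simp
  qed
  then have fin: "finite S" using finite_subset by blast
  have "cycle_subdigraph (independent_composition T H) {}" by (simp add: cycle_subdigraph_iff)
  then have "S \<noteq> {}" by (auto simp: S_def)
  then have "Max S \<in> S" using fin by (rule Max_in[rotated])
  then show "\<exists>C. cycle_subdigraph (independent_composition T H) C
      \<and> m_val T H u = card ((\<Union>c\<in>C. set c) \<inter> ({u} \<times> verts (H u)))"
    unfolding m by (auto simp: S_def)
  show "card ((\<Union>c\<in>C. set c) \<inter> ({u} \<times> verts (H u))) \<le> m_val T H u"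
    if "cycle_subdigraph (independent_composition T H) C"
    unfolding m using that fin by (intro Max_ge) (auto simp: S_def)
qed

text \<open>A family covering most vertices is optimal for every block at once. Its projected cycles
  merge into a closed walk of \<open>T\<close>, whose lift is again a cycle subdigraph, so the visit
  counts do not exceed the maxima either.\<close>

lemma ex_closed_walk_m_val:
  fixes T :: "'a digraph" and H :: "'a \<Rightarrow> 'b digraph"
  assumes T: "wf_digraph T" "semicomplete T" "card (verts T) \<ge> 2"
    and H: "\<forall>u\<in>verts T. wf_digraph (H u) \<and> verts (H u) \<noteq> {}"
    and leaving: "\<And>X. \<lbrakk>X \<noteq> {}; X \<subset> verts T\<rbrakk> \<Longrightarrow> \<exists>u\<in>X. \<exists>v\<in>verts T - X. arc T u v"
  shows "\<exists>w. closed_walk (arc T) w \<and> (\<forall>u\<in>verts T. count (mset w) u = m_val T H u \<and> m_val T H u \<ge> 1)"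
proof -
  define V where "V = (SIGMA u:verts T. verts (H u))"
  let ?K = "independent_composition T H"
  let ?LF = "loopy_factor V fst (arc T)"
  have finT: "finite (verts T)" and finH: "\<And>u. u \<in> verts T \<Longrightarrow> finite (verts (H u))"
    using T H by (auto simp: wf_digraph_def)
  then have finV: "finite V" by (auto simp: V_def)
  have id: "?LF id" by (auto simp: loopy_factor_def)
  have bnd: "\<forall>f. ?LF f \<longrightarrow> card {x \<in> V. f x \<noteq> x} < Suc (card V)"
    using finV by (auto simp: less_Suc_eq_le intro!: card_mono)
  obtain f where f: "?LF f"
    and max: "\<And>g. ?LF g \<Longrightarrow> card {x \<in> V. g x \<noteq> x} \<le> card {x \<in> V. f x \<noteq> x}"
    using ex_has_greatest_nat[of ?LF id "\<lambda>f. card {x \<in> V. f x \<noteq> x}", OF id bnd] by blast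
  define S where "S = {x \<in> V. f x \<noteq> x}"
  have fp: "f permutes V" using f by (simp add: loopy_factor_def)
  have block: "card ((\<Union>c\<in>C. set c) \<inter> ({u} \<times> verts (H u))) \<le> card {x \<in> S. fst x = u}"
    if C: "cycle_subdigraph ?K C" and u: "u \<in> verts T" for C u
  proof -
    obtain g where g: "?LF g" "{x. g x \<noteq> x} = (\<Union>c\<in>C. set c)"
      using loopy_factor_of_cycle_subdigraph[OF T(1) C] unfolding V_def by blast
    have "{x. g x \<noteq> x} \<inter> ({u} \<times> verts (H u)) = {x \<in> V. fst x = u \<and> g x \<noteq> x}"
      using u by (auto simp: V_def)
    moreover have "card {x \<in> V. fst x = u \<and> g x \<noteq> x} \<le> card {x \<in> V. fst x = u \<and> f x \<noteq> x}"
    proof (rule max_loopy_factor_covers_blocks[OF finV _ _ f max g(1)])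
      show "\<not> arc T v v" for v by (rule wf_digraph_irrefl[OF T(1)])
      show "arc T (fst x) (fst y) \<or> arc T (fst y) (fst x)"
        if "x \<in> V" "y \<in> V" "fst x \<noteq> fst y" for x y
      proof -
        have "fst x \<in> verts T" "fst y \<in> verts T" using that by (auto simp: V_def)
        then show ?thesis using T(2) that(3) unfolding semicomplete_def by blast
      qed
    qed
    moreover have "{x \<in> V. fst x = u \<and> f x \<noteq> x} = {x \<in> S. fst x = u}" by (auto simp: S_def)
    ultimately show ?thesis using g(2) by simp
  qed
  \<comment> \<open>Every block is met, so the projected cycles span \<open>T\<close>, as the
    merging requires. The witness is a cycle of \<open>T\<close> through \<open>u\<close>, lifted by
    choosing one vertex per block.\<close>
  have pos: "card {x \<in> S. fst x = u} \<ge> 1" if u: "u \<in> verts T" for u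
  proof -
    have "verts T \<noteq> {u}" using T(3) by auto
    then obtain w where w: "closed_walk (arc T) w" "distinct w" "u \<in> set w"
      using ex_distinct_closed_walk_through[OF T(1) u _ leaving] by blast
    define h where "h v = (v, SOME x. x \<in> verts (H v))" for v
    have h: "h v \<in> {v} \<times> verts (H v)" if "v \<in> verts T" for v
      using H that by (auto simp: h_def some_in_eq)
    have wT: "set w \<subseteq> verts T" by (rule closed_walk_set_verts[OF T(1) w(1)])
    have "is_cycle ?K (map h w)" unfolding is_cycle_iff
    proof (intro conjI)
      show "distinct (map h w)" using w(2) by (auto simp: distinct_map inj_on_def h_def)
      show "set (map h w) \<subseteq> verts ?K" using wT h by (force simp: verts_composition)
      show "closed_walk (arc ?K) (map h w)" unfolding closed_walk_map
        by (rule closed_walk_cong_set[OF w(1)])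
           (use wT h in \<open>auto simp: h_def arcs_composition\<close>)
    qed
    then have "cycle_subdigraph ?K {map h w}" by (simp add: cycle_subdigraph_iff)
    from block[OF this u] have "card (h ` set w \<inter> ({u} \<times> verts (H u))) \<le> card {x \<in> S. fst x = u}"
      by simp
    moreover have "h u \<in> h ` set w \<inter> ({u} \<times> verts (H u))" using w(3) h[OF u] by blast
    then have "card (h ` set w \<inter> ({u} \<times> verts (H u))) \<ge> 1"
      by (metis One_nat_def Suc_leI card_gt_0_iff empty_iff finite_Int finite_imageI List.finite_set)
    ultimately show ?thesis by linarith
  qed
  \<comment> \<open>Without its fixed points the permutation follows arcs of \<open>T\<close>
    everywhere, so its cycles project to closed walks.\<close>
  have "f permutes S" using fp by (rule permutes_superset) (auto simp: S_def)
  moreover have finS: "finite S" using finV by (simp add: S_def)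
  ultimately obtain F where F: "\<And>w. w \<in># F \<Longrightarrow> w \<noteq> [] \<and> set w \<subseteq> S \<and> map f w = rotate1 w"
    "(\<Sum>w\<in>#F. mset w) = mset_set S" using ex_cycle_family_of_permutation by metis
  define F' where "F' = image_mset (map fst) F"
  have sumF': "(\<Sum>w\<in>#F'. mset w) = image_mset fst (mset_set S)"
  proof -
    have "(\<Sum>w\<in>#image_mset (map fst) G. mset w) = image_mset fst (\<Sum>w\<in>#G. mset w)"
      for G :: "('a \<times> 'b) list multiset"
      by (induction G) auto
    then show ?thesis using F(2) by (simp add: F'_def)
  qed
  have fstS: "fst ` S = verts T"
  proof
    show "fst ` S \<subseteq> verts T" by (auto simp: S_def V_def)
    show "verts T \<subseteq> fst ` S"
    proof
      fix u assume "u \<in> verts T"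
      then have "{x \<in> S. fst x = u} \<noteq> {}" using pos by (metis card.empty not_one_le_zero)
      then show "u \<in> fst ` S" by blast
    qed
  qed
  have "\<exists>w. closed_walk (arc T) w \<and> mset w = (\<Sum>w\<in>#F'. mset w)"
  proof (rule merge_closed_walk_family)
    have "S \<noteq> {}" using fstS T(3) by auto
    then show "F' \<noteq> {#}" using F(2) finS by (auto simp: F'_def mset_set_empty_iff)
    show "closed_walk (arc T) w" if w: "w \<in># F'" for w
    proof -
      obtain w' where w': "w' \<in># F" "w = map fst w'" using w by (auto simp: F'_def)
      have "arc T (fst x) (fst (f x))" if "x \<in> set w'" for x
        using F(1)[OF w'(1)] f that unfolding S_def loopy_factor_def by blast
      then show ?thesis
        using F(1)[OF w'(1)] unfolding w'(2) closed_walk_map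
        by (subst closed_walk_iff_succ_map[of f]) auto
    qed
    have "(\<Union>w\<in>set_mset F'. set w) = set_mset (\<Sum>w\<in>#F'. mset w)" by simp
    also have "\<dots> = verts T" unfolding sumF' using finS fstS by simp
    finally show "verts T = (\<Union>w\<in>set_mset F'. set w)" ..
    show "arc T x y \<or> arc T y x" if "x \<in> verts T" "y \<in> verts T" "x \<noteq> y" for x y
      using T(2) that by (simp add: semicomplete_def)
  qed (rule leaving)
  then obtain w where w: "closed_walk (arc T) w" "mset w = image_mset fst (mset_set S)"
    using sumF' by auto
  have cnt: "count (mset w) u = card {x \<in> S. fst x = u}" for u
    unfolding w(2) using finS by (rule count_image_mset_eq_card_vimage)
  \<comment> \<open>Lifting with one-vertex paths turns the merged walk into one cycle on exactly
    the vertices of \<open>S\<close>.\<close>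
  have "\<exists>c. is_cycle ?K c \<and> set c = (SIGMA u:UNIV. \<Union>p\<in>(\<lambda>x. [x]) ` {x. (u, x) \<in> S}. set p)"
  proof (rule substitute_paths_in_closed_walk[OF T(1) w(1)])
    fix u
    have eq: "{x \<in> S. fst x = u} = Pair u ` {x. (u, x) \<in> S}" by force
    have "finite (Pair u ` {x. (u, x) \<in> S})" using finS unfolding eq[symmetric] by simp
    then have "finite {x. (u, x) \<in> S}" by (rule finite_imageD) (auto simp: inj_on_def)
    then show "finite ((\<lambda>x. [x]) ` {x. (u, x) \<in> S})" by simp
    show "card ((\<lambda>x. [x]) ` {x. (u, x) \<in> S}) = count (mset w) u"
      unfolding cnt eq by (simp add: card_image inj_on_def)
  next
    show "is_path (empty_digraph (verts (H u))) p" if "p \<in> (\<lambda>x. [x]) ` {x. (u, x) \<in> S}" for u p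
      using that by (auto simp: is_path_iff S_def V_def)
  qed auto
  then obtain c where c: "is_cycle ?K c" "set c = S" by (force simp: Sigma_def)
  have "card {x \<in> S. fst x = u} = m_val T H u" if u: "u \<in> verts T" for u
  proof (rule antisym)
    have "cycle_subdigraph ?K {c}" using c by (simp add: cycle_subdigraph_iff)
    from m_val_greatest(1)[where H = H and u = u, OF finH[OF u] this]
    have "card (S \<inter> ({u} \<times> verts (H u))) \<le> m_val T H u" using c by simp
    moreover have "S \<inter> ({u} \<times> verts (H u)) = {x \<in> S. fst x = u}" by (auto simp: S_def V_def)
    ultimately show "card {x \<in> S. fst x = u} \<le> m_val T H u" by simp
    obtain C where C: "cycle_subdigraph ?K C"
      "m_val T H u = card ((\<Union>c\<in>C. set c) \<inter> ({u} \<times> verts (H u)))"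
      using m_val_greatest(2)[where H = H and u = u and T = T, OF finH[OF u]] by blast
    show "m_val T H u \<le> card {x \<in> S. fst x = u}"
      unfolding C(2) by (rule block[OF C(1) u])
  qed
  then show ?thesis using w(1) cnt pos by (intro exI[of _ w]) auto
qed

section \<open>Path-cycle factors\<close>

lemma path_cycle_factor_iff:
  "path_cycle_factor G P C \<longleftrightarrow> finite P \<and> finite C \<and> P \<inter> C = {} \<and> (\<forall>p\<in>P. is_path G p) \<and>
     (\<forall>c\<in>C. is_cycle G c) \<and> (\<forall>x\<in>P \<union> C. \<forall>y\<in>P \<union> C. x \<noteq> y \<longrightarrow> set x \<inter> set y = {}) \<and>
     (\<Union>x\<in>P \<union> C. set x) = verts G"
  by (auto simp: path_cycle_factor_def path_cycle_sub_def)

text \<open>The list that represents a cycle also represents the path left after deleting its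
  closing arc, so the same list changes sides.\<close>

lemma path_cycle_factor_break_cycle:
  assumes "path_cycle_factor G P C" "c \<in> C"
  shows "path_cycle_factor G (insert c P) (C - {c})"
    and "card (insert c P) = Suc (card P)" "card C = Suc (card (C - {c}))"
proof -
  have eq: "insert c P \<union> (C - {c}) = P \<union> C" using assms(2) by auto
  have "is_path G c" "c \<notin> P" "finite C" "finite P"
    using assms by (auto simp: path_cycle_factor_iff is_cycle_def)
  then show "path_cycle_factor G (insert c P) (C - {c})"
    using assms unfolding path_cycle_factor_iff eq by auto
  show "card (insert c P) = Suc (card P)" using \<open>finite P\<close> \<open>c \<notin> P\<close> by simp
  show "card C = Suc (card (C - {c}))" using card.remove[OF \<open>finite C\<close> assms(2)] by simp
qed

text \<open>Fewer paths than vertices force a path with at least two vertices, whose first vertex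
  can be cut off.\<close>

lemma path_cycle_factor_split_path:
  assumes P: "path_cycle_factor G P {}" and small: "card P < card (verts G)"
  shows "\<exists>P'. path_cycle_factor G P' {} \<and> card P' = Suc (card P)"
proof -
  have "\<exists>p\<in>P. length p \<ge> 2"
  proof (rule ccontr)
    assume *: "\<not> ?thesis"
    have fin: "finite P" using P by (simp add: path_cycle_factor_iff)
    have "card (verts G) = card (\<Union>p\<in>P. set p)" using P by (auto simp: path_cycle_factor_iff)
    also have "\<dots> \<le> (\<Sum>p\<in>P. card (set p))" by (rule card_UN_le[OF fin])
    also have "\<dots> \<le> (\<Sum>p\<in>P. 1)"
      using * by (intro sum_mono order_trans[OF card_length]) force
    finally show False using small by simp
  qed
  then obtain p where p: "p \<in> P" "length p \<ge> 2" by blast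
  then obtain a b r where abr: "p = a # b # r"
    by (metis Suc_le_length_iff numeral_2_eq_2)
  have path: "is_path G p" using P p by (simp add: path_cycle_factor_iff)
  define P' where "P' = insert [a] (insert (b # r) (P - {p}))"
  have disj: "set x \<inter> set y = {}" if "x \<in> P" "y \<in> P" "x \<noteq> y" for x y
    using P that by (simp add: path_cycle_factor_iff)
  have dp: "set x \<inter> set p = {}" if "x \<in> P - {p}" for x using disj[of x p] that p by auto
  have ne: "[a] \<notin> P - {p}" "b # r \<notin> P - {p}" "[a] \<noteq> b # r"
    using dp[of "[a]"] dp[of "b # r"] path abr by (auto simp: is_path_iff)
  have fin: "finite P" using P by (simp add: path_cycle_factor_iff)
  have "card P' = Suc (card P)"
    using fin ne p card.remove[OF fin p(1)] by (simp add: P'_def)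
  moreover have "path_cycle_factor G P' {}"
    unfolding path_cycle_factor_iff
  proof (intro conjI)
    show "finite P'" using fin by (simp add: P'_def)
    show "\<forall>q\<in>P'. is_path G q"
      using P path unfolding abr P'_def by (auto simp: path_cycle_factor_iff is_path_iff)
    have "(\<Union>q\<in>P'. set q) = set p \<union> (\<Union>q\<in>P - {p}. set q)" by (auto simp: P'_def abr)
    also have "\<dots> = (\<Union>q\<in>P. set q)" using p by auto
    finally show "(\<Union>q\<in>P' \<union> {}. set q) = verts G" using P by (simp add: path_cycle_factor_iff)
    have ab: "set [a] \<inter> set (b # r) = {}" using path by (auto simp: abr is_path_iff)
    show "\<forall>x\<in>P' \<union> {}. \<forall>y\<in>P' \<union> {}. x \<noteq> y \<longrightarrow> set x \<inter> set y = {}"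
    proof (intro ballI impI)
      fix x y assume "x \<in> P' \<union> {}" "y \<in> P' \<union> {}" "x \<noteq> y"
      then consider "x \<in> P - {p}" "y \<in> P - {p}" | "x \<in> {[a], b # r}" "y \<in> P - {p}"
        | "x \<in> P - {p}" "y \<in> {[a], b # r}" | "x \<in> {[a], b # r}" "y \<in> {[a], b # r}"
        unfolding P'_def by blast
      then show "set x \<inter> set y = {}"
      proof cases
        case 1 then show ?thesis using disj \<open>x \<noteq> y\<close> by blast
      next
        case 2 then show ?thesis using dp[of y] abr by auto
      next
        case 3 then show ?thesis using dp[of x] abr by auto
      next
        case 4 then show ?thesis using ab \<open>x \<noteq> y\<close> by auto
      qed
    qed
  qed auto
  ultimately show ?thesis by blast
qed

text \<open>Settles the blocks outside \<open>I_set\<close>: there m_i paths cover everything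
  without a cycle.\<close>

lemma ex_path_factor_card:
  assumes "finite (verts G)" "pc G \<le> m" "m \<le> card (verts G)"
  shows "\<exists>P. path_cycle_factor G P {} \<and> card P = m"
  using assms(2,3)
proof (induction m rule: dec_induct)
  case base
  have "path_cycle_factor G ((\<lambda>v. [v]) ` verts G) {}"
    using assms(1) by (auto simp: path_cycle_factor_iff is_path_iff)
  then have "\<exists>k P. card P = k \<and> path_cycle_factor G P {}" by blast
  from LeastI_ex[OF this] show ?case unfolding pc_def by blast
next
  case (step m)
  then show ?case using path_cycle_factor_split_path[of G] by fastforce
qed

lemma pc_le: "path_cycle_factor G P {} \<Longrightarrow> pc G \<le> card P"
  unfolding pc_def by (rule Least_le) blast

text \<open>Opening a cycle into a path shows \<open>\<eta>\<^sub>j \<le> \<eta>\<^sub>j\<^sub>+\<^sub>1 + 1\<close>, so that the first \<open>\<eta>\<^sub>j\<close>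
  not exceeding \<open>m < \<eta>\<^sub>0\<close> is equal to \<open>m\<close>.\<close>

lemma ex_eta_eq:
  assumes "path_cycle_factor G P C" "card P \<le> m" "m < pc G"
  shows "\<exists>j\<le>card C. eta G j = enat m"
proof -
  define Q where "Q j \<longleftrightarrow> (\<exists>P C. path_cycle_factor G P C \<and> card C = j \<and> card P \<le> m)" for j
  define j where "j = (LEAST j. Q j)"
  have Q: "Q (card C)" using assms(1,2) by (auto simp: Q_def)
  have "Q j" unfolding j_def using Q by (rule LeastI)
  have jC: "j \<le> card C" unfolding j_def using Q by (rule Least_le)
  have least: "\<not> Q i" if "i < j" for i using that unfolding j_def by (rule not_less_Least)
  \<comment> \<open>With fewer than \<open>m\<close> paths, opening a cycle would leave at most
    \<open>m\<close> paths and one cycle less, against the choice of \<open>j\<close>; without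
    cycles, \<open>m < pc G\<close> excludes it.\<close>
  have ge: "card P' \<ge> m" if P': "path_cycle_factor G P' C'" "card C' = j" for P' C'
  proof (cases "C' = {}")
    case True
    then show ?thesis using pc_le[of G P'] P' assms(3) by simp
  next
    case False
    then obtain c where c: "c \<in> C'" by blast
    note b = path_cycle_factor_break_cycle[OF P'(1) c]
    have "\<not> Q (card (C' - {c}))" using b(3) P'(2) by (intro least) simp
    then show ?thesis using b unfolding Q_def by (metis not_less_eq_eq)
  qed
  obtain P' C' where P': "path_cycle_factor G P' C'" "card C' = j" "card P' \<le> m"
    using \<open>Q j\<close> by (auto simp: Q_def)
  have "eta G j = enat m" unfolding eta_def
  proof (rule antisym)
    have "card P' = m" using ge[OF P'(1,2)] P'(3) by simp
    then show "Inf {enat i |i. \<exists>P C. card P = i \<and> card C = j \<and> path_cycle_factor G P C} \<le> enat m"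
      using P' by (intro Inf_lower) blast
    show "enat m \<le> Inf {enat i |i. \<exists>P C. card P = i \<and> card C = j \<and> path_cycle_factor G P C}"
      using ge by (intro Inf_greatest) auto
  qed
  then show ?thesis using jC by blast
qed

text \<open>A finite value excludes the empty set, whose infimum is infinity, and a nonempty set of
  extended naturals contains its infimum.\<close>

lemma eta_eq_enatD:
  assumes "eta G j = enat m"
  shows "\<exists>P C. path_cycle_factor G P C \<and> card P = m \<and> card C = j"
proof -
  let ?A = "{enat i |i. \<exists>P C. card P = i \<and> card C = j \<and> path_cycle_factor G P C}"
  have "?A \<noteq> {}"
  proof
    assume "?A = {}"
    then have "eta G j = Inf {}" unfolding eta_def by (rule arg_cong)
    then show False using assms by (simp add: top_enat_def)
  qed
  then obtain k where "k \<in> ?A" by blast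
  then have "Inf ?A \<in> ?A" by (rule wellorder_InfI)
  then have "enat m \<in> ?A" using assms by (simp add: eta_def)
  then show ?thesis by auto
qed

section \<open>The bounds\<close>

text \<open>As \<open>T\<close> has no loops, the arcs inside a block are just those of
  \<open>H u\<close>.\<close>

lemma is_cycle_map_Pair:
  assumes T: "wf_digraph T" and u: "u \<in> verts T"
  shows "is_cycle (composition T H) (map (Pair u) c) \<longleftrightarrow> is_cycle (H u) c"
proof -
  have "closed_walk (\<lambda>x y. arc (composition T H) (u, x) (u, y)) c \<longleftrightarrow> closed_walk (arc (H u)) c"
    if "set c \<subseteq> verts (H u)"
  proof
    show "closed_walk (arc (H u)) c" if "closed_walk (\<lambda>x y. arc (composition T H) (u, x) (u, y)) c"
      using that by (rule closed_walk_cong_set) (auto simp: arcs_composition wf_digraph_irrefl[OF T])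
    show "closed_walk (\<lambda>x y. arc (composition T H) (u, x) (u, y)) c" if "closed_walk (arc (H u)) c"
      using that by (rule closed_walk_cong_set)
        (use u \<open>set c \<subseteq> verts (H u)\<close> in \<open>auto simp: arcs_composition\<close>)
  qed
  moreover have "set (map (Pair u) c) \<subseteq> verts (composition T H) \<longleftrightarrow> set c \<subseteq> verts (H u)"
    using u by (auto simp: verts_composition)
  ultimately show ?thesis
    by (auto simp: is_cycle_iff closed_walk_map distinct_map inj_on_def)
qed

text \<open>One cycle threads all paths of all \<open>P u\<close> along \<open>w\<close>; with the
  cycles inside the blocks it spans everything, whence the summand 1.\<close>

lemma cycle_factor_upper:
  fixes T :: "'a digraph" and H :: "'a \<Rightarrow> 'b digraph"
  assumes T: "wf_digraph T" and w: "closed_walk (arc T) w"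
    and P: "\<And>u. u \<in> verts T \<Longrightarrow> path_cycle_factor (H u) (P u) (C u)"
    and card: "\<And>u. u \<in> verts T \<Longrightarrow> card (P u) = count (mset w) u"
  shows "\<exists>D. cycle_factor (composition T H) D \<and> card D = 1 + (\<Sum>u\<in>verts T. card (C u))"
proof -
  \<comment> \<open>Outside \<open>T\<close> the given \<open>P\<close> is arbitrary while
    \<open>w\<close> makes no visits; the default \<open>{}\<close> matches the count 0.\<close>
  define P' where "P' u = (if u \<in> verts T then P u else {})" for u
  have wT: "set w \<subseteq> verts T" by (rule closed_walk_set_verts[OF T w])
  have finP: "finite (P u)" and finC: "finite (C u)" if "u \<in> verts T" for u
    using P[OF that] by (auto simp: path_cycle_factor_iff)
  have finT: "finite (verts T)" using T by (simp add: wf_digraph_def)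
  have "\<exists>c. is_cycle (composition T H) c \<and> set c = (SIGMA u:UNIV. \<Union>p\<in>P' u. set p)"
  proof (rule substitute_paths_in_closed_walk[OF T w])
    show "finite (P' u)" for u using finP by (simp add: P'_def)
    show "card (P' u) = count (mset w) u" for u
    proof (cases "u \<in> verts T")
      case False
      then have "u \<notin># mset w" using wT by auto
      then show ?thesis using False by (simp add: P'_def not_in_iff)
    qed (simp add: P'_def card)
    show "is_path (H u) p" if "p \<in> P' u" for u p
      using P that by (auto simp: P'_def path_cycle_factor_iff split: if_splits)
    show "set p \<inter> set q = {}" if "p \<in> P' u" "q \<in> P' u" "p \<noteq> q" for u p q
      using P[of u] that by (auto simp: P'_def path_cycle_factor_iff split: if_splits)
  qed
  then obtain c where c: "is_cycle (composition T H) c"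
    "set c = (SIGMA u:UNIV. \<Union>p\<in>P' u. set p)" by blast
  define E where "E u = map (Pair u) ` C u" for u
  have cyc: "is_cycle (composition T H) d" and setd: "set d \<subseteq> {u} \<times> (\<Union>x\<in>C u. set x)"
    and dne: "d \<noteq> []" if ud: "u \<in> verts T" "d \<in> E u" for u d
  proof -
    obtain x where x: "x \<in> C u" "d = map (Pair u) x" using ud by (auto simp: E_def)
    then have "is_cycle (H u) x" using P ud by (simp add: path_cycle_factor_iff)
    then show "is_cycle (composition T H) d" using is_cycle_map_Pair[OF T ud(1)] x by blast
    then show "d \<noteq> []" by (auto simp: is_cycle_iff closed_walk_def)
    show "set d \<subseteq> {u} \<times> (\<Union>x\<in>C u. set x)" using x by auto
  qed
  define D where "D = insert c (\<Union>u\<in>verts T. E u)"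
  have PC_disj: "(\<Union>x\<in>P u. set x) \<inter> (\<Union>x\<in>C u. set x) = {}" if "u \<in> verts T" for u
  proof -
    have "P u \<inter> C u = {}"
      and disj: "\<forall>x\<in>P u \<union> C u. \<forall>y\<in>P u \<union> C u. x \<noteq> y \<longrightarrow> set x \<inter> set y = {}"
      using P[OF that] by (simp_all add: path_cycle_factor_iff)
    then have "x \<noteq> y" if "x \<in> P u" "y \<in> C u" for x y using that by blast
    then have "set x \<inter> set y = {}" if "x \<in> P u" "y \<in> C u" for x y using disj that by simp
    then show ?thesis by blast
  qed
  have c_disj: "set c \<inter> set d = {}" if "u \<in> verts T" "d \<in> E u" for u d
  proof -
    have "b \<in> (\<Union>x\<in>P u. set x)" if "(u, b) \<in> set c" for b
      using that \<open>u \<in> verts T\<close> unfolding c(2) by (simp add: P'_def)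
    then show ?thesis using setd[OF that] PC_disj[OF that(1)] by blast
  qed
  have E_disj: "set d \<inter> set e = {}"
    if uv: "u \<in> verts T" "v \<in> verts T" "d \<in> E u" "e \<in> E v" "d \<noteq> e" for u v d e
  proof (cases "u = v")
    case True
    obtain x y where xy: "x \<in> C u" "d = map (Pair u) x" "y \<in> C u" "e = map (Pair u) y"
      using uv True by (auto simp: E_def)
    have "x \<noteq> y" using xy uv(5) by auto
    moreover have "\<forall>x\<in>P u \<union> C u. \<forall>y\<in>P u \<union> C u. x \<noteq> y \<longrightarrow> set x \<inter> set y = {}"
      using P[OF uv(1)] by (simp add: path_cycle_factor_iff)
    ultimately have "set x \<inter> set y = {}" using xy by simp
    then show ?thesis using xy by auto
  next
    case False
    then show ?thesis using setd[of u d] setd[of v e] uv by auto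
  qed
  have finD: "finite D" using finT finC by (simp add: D_def E_def)
  have cover: "(\<Union>d\<in>D. set d) = verts (composition T H)"
  proof -
    have "(\<Union>d\<in>E u. set d) = {u} \<times> (\<Union>x\<in>C u. set x)" for u by (auto simp: E_def)
    then have "(\<Union>d\<in>D. set d) = set c \<union> (\<Union>u\<in>verts T. {u} \<times> (\<Union>x\<in>C u. set x))"
      by (simp add: D_def)
    also have "set c = (\<Union>u\<in>verts T. {u} \<times> (\<Union>x\<in>P u. set x))"
      by (auto simp: c(2) P'_def split: if_splits)
    also have "\<dots> \<union> (\<Union>u\<in>verts T. {u} \<times> (\<Union>x\<in>C u. set x))
        = (\<Union>u\<in>verts T. {u} \<times> (\<Union>x\<in>P u \<union> C u. set x))" by auto
    also have "\<dots> = (\<Union>u\<in>verts T. {u} \<times> verts (H u))"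
      using P by (intro SUP_cong) (simp_all add: path_cycle_factor_iff)
    also have "\<dots> = verts (composition T H)" by (auto simp: verts_composition)
    finally show ?thesis .
  qed
  have "cycle_factor (composition T H) D"
    unfolding cycle_factor_def path_cycle_factor_iff
  proof (intro conjI)
    show "\<forall>x\<in>D. is_cycle (composition T H) x" using c(1) cyc by (auto simp: D_def)
    show "\<forall>x\<in>{} \<union> D. \<forall>y\<in>{} \<union> D. x \<noteq> y \<longrightarrow> set x \<inter> set y = {}"
    proof (intro ballI impI)
      fix x y assume "x \<in> {} \<union> D" "y \<in> {} \<union> D" "x \<noteq> y"
      then consider u v where "u \<in> verts T" "x \<in> E u" "v \<in> verts T" "y \<in> E v"
        | u where "x = c" "u \<in> verts T" "y \<in> E u" | u where "y = c" "u \<in> verts T" "x \<in> E u"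
        unfolding D_def by blast
      then show "set x \<inter> set y = {}"
      proof cases
        case 1 then show ?thesis using E_disj \<open>x \<noteq> y\<close> by blast
      next
        case 2 then show ?thesis using c_disj by blast
      next
        case 3 then show ?thesis using c_disj by blast
      qed
    qed
  qed (use finD cover in simp_all)
  moreover have "card D = 1 + (\<Sum>u\<in>verts T. card (C u))"
  proof -
    have "c \<notin> (\<Union>u\<in>verts T. E u)"
    proof
      assume "c \<in> (\<Union>u\<in>verts T. E u)"
      then obtain u where u: "u \<in> verts T" "c \<in> E u" by blast
      then show False using c_disj[OF u] dne[OF u] by simp
    qed
    then have "card D = 1 + card (\<Union>u\<in>verts T. E u)"
      using finT finC by (simp add: D_def E_def)
    also have "card (\<Union>u\<in>verts T. E u) = (\<Sum>u\<in>verts T. card (E u))"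
    proof (rule card_UN_disjoint[OF finT])
      show "\<forall>u\<in>verts T. finite (E u)" using finC by (simp add: E_def)
      show "\<forall>u\<in>verts T. \<forall>v\<in>verts T. u \<noteq> v \<longrightarrow> E u \<inter> E v = {}"
      proof (intro ballI impI equals0I)
        fix u v d assume *: "u \<in> verts T" "v \<in> verts T" "u \<noteq> v" "d \<in> E u \<inter> E v"
        then have "set d \<subseteq> {u} \<times> UNIV" "set d \<subseteq> {v} \<times> UNIV" "hd d \<in> set d"
          using setd[of u d] setd[of v d] dne[of u d] by auto
        then have "fst (hd d) = u" "fst (hd d) = v" by force+
        then show False using *(3) by simp
      qed
    qed
    also have "\<dots> = (\<Sum>u\<in>verts T. card (C u))"
      by (intro sum.cong refl) (simp add: E_def card_image inj_on_def inj_map_eq_map)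
    finally show ?thesis .
  qed
  ultimately show ?thesis by blast
qed

text \<open>Cycles within a block are kept; the others are cut into runs, which become the paths. In
  the last conjunct, equality means that no cycle crosses between blocks, so that no paths
  arise.\<close>

lemma cycle_factor_restricts_to_blocks:
  fixes T :: "'a digraph" and H :: "'a \<Rightarrow> 'b digraph"
  assumes T: "wf_digraph T" and H: "\<And>u. u \<in> verts T \<Longrightarrow> finite (verts (H u))"
    and D: "cycle_factor (composition T H) D"
  shows "\<exists>P C. (\<forall>u\<in>verts T. path_cycle_factor (H u) (P u) (C u) \<and> card (P u) \<le> m_val T H u)
    \<and> (\<Sum>u\<in>verts T. card (C u)) \<le> card D
    \<and> (card D = (\<Sum>u\<in>verts T. card (C u)) \<longrightarrow> (\<forall>u\<in>verts T. P u = {}))"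
proof -
  let ?Q = "composition T H" and ?K = "independent_composition T H"
  have finD: "finite D" and cyc: "\<And>d. d \<in> D \<Longrightarrow> is_cycle ?Q d"
    and disj: "\<And>d e. \<lbrakk>d \<in> D; e \<in> D; d \<noteq> e\<rbrakk> \<Longrightarrow> set d \<inter> set e = {}"
    and cover: "(\<Union>d\<in>D. set d) = verts ?Q"
    using D by (auto simp: cycle_factor_def path_cycle_factor_iff)
  have dne: "d \<noteq> []" if "d \<in> D" for d using cyc[OF that] by (auto simp: is_cycle_iff closed_walk_def)
  have finT: "finite (verts T)" using T by (simp add: wf_digraph_def)
  \<comment> \<open>Equality with \<open>{u}\<close> instead of inclusion makes these sets disjoint
    for different \<open>u\<close> at once.\<close>
  define In where "In u = {d \<in> D. fst ` set d = {u}}" for u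
  define Out where "Out = {d \<in> D. \<nexists>u. fst ` set d \<subseteq> {u}}"
  have In_Out: "In u \<inter> Out = {}" for u by (auto simp: In_def Out_def)
  have "\<forall>d\<in>Out. \<exists>zs. distinct (expand zs) \<and> set (expand zs) = set d \<and>
      (\<forall>(u, p)\<in>set zs. is_path (H u) p) \<and> closed_walk (\<lambda>x y. arc T (fst x) (fst y)) zs"
    using cycle_runs[OF T cyc] by (simp add: Out_def)
  then obtain R where R: "\<And>d. d \<in> Out \<Longrightarrow> distinct (expand (R d))"
    "\<And>d. d \<in> Out \<Longrightarrow> set (expand (R d)) = set d"
    "\<And>d u p. \<lbrakk>d \<in> Out; (u, p) \<in> set (R d)\<rbrakk> \<Longrightarrow> is_path (H u) p"
    "\<And>d. d \<in> Out \<Longrightarrow> closed_walk (\<lambda>x y. arc T (fst x) (fst y)) (R d)"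
    by (metis (no_types, lifting) case_prodD)
  define P where "P u = {p. \<exists>d\<in>Out. (u, p) \<in> set (R d)}" for u
  define C where "C u = map snd ` In u" for u
  have Pd: "p \<noteq> []" "Pair u ` set p \<subseteq> set d" if "d \<in> Out" "(u, p) \<in> set (R d)" for d u p
    using R(3)[OF that] R(2)[OF that(1)] that(2) by (auto simp: is_path_iff set_expand)
  have In_eq: "d = map (Pair u) (map snd d)" if "d \<in> In u" for d u
  proof -
    have "fst z = u" if "z \<in> set d" for z using \<open>d \<in> In u\<close> that unfolding In_def by blast
    then have "map (Pair u \<circ> snd) d = d" by (intro map_idI) (metis comp_apply prod.collapse)
    then show ?thesis by simp
  qed
  have Cd: "Pair u ` set x \<subseteq> set d" if "d \<in> In u" "x = map snd d" for u d x
    using In_eq[OF that(1)] that(2) by (metis list.set_map order_refl)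
  have PP: "set p \<inter> set q = {}" if pq: "p \<in> P u" "q \<in> P u" "p \<noteq> q" for u p q
  proof -
    obtain d e where de: "d \<in> Out" "(u, p) \<in> set (R d)" "e \<in> Out" "(u, q) \<in> set (R e)"
      using pq by (auto simp: P_def)
    show ?thesis
    proof (cases "d = e")
      case True
      then show ?thesis using distinct_expand_disjoint[OF R(1)[OF de(1)]] de pq(3) by blast
    next
      case False
      then have "set d \<inter> set e = {}" using de by (intro disj) (auto simp: Out_def)
      then show ?thesis using Pd(2)[OF de(1,2)] Pd(2)[OF de(3,4)] by blast
    qed
  qed
  have PC: "set p \<inter> set x = {}" if px: "p \<in> P u" "x \<in> C u" for u p x
  proof -
    obtain d e where de: "d \<in> Out" "(u, p) \<in> set (R d)" "e \<in> In u" "x = map snd e"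
      using px by (auto simp: P_def C_def)
    then have "set d \<inter> set e = {}" using In_Out[of u] by (intro disj) (auto simp: Out_def In_def)
    then show ?thesis using Pd(2)[OF de(1,2)] Cd[OF de(3,4)] by blast
  qed
  have CC: "set x \<inter> set y = {}" if xy: "x \<in> C u" "y \<in> C u" "x \<noteq> y" for u x y
  proof -
    obtain d e where de: "d \<in> In u" "x = map snd d" "e \<in> In u" "y = map snd e"
      using xy by (auto simp: C_def)
    then have "set d \<inter> set e = {}" using xy(3) by (intro disj) (auto simp: In_def)
    then show ?thesis using Cd[OF de(1,2)] Cd[OF de(3,4)] by blast
  qed
  have finOut: "finite Out" and finIn: "\<And>u. finite (In u)"
    using finD by (auto simp: Out_def In_def)
  have finP: "finite (P u)" for u
  proof -
    have "P u = (\<Union>d\<in>Out. snd ` {z \<in> set (R d). fst z = u})" by (force simp: P_def)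
    then show ?thesis using finOut by simp
  qed
  have paths: "is_path (H u) p" if "p \<in> P u" for u p using that R(3) by (auto simp: P_def)
  have cycles: "is_cycle (H u) x" if x: "x \<in> C u" "u \<in> verts T" for u x
  proof -
    obtain d where d: "d \<in> In u" "x = map snd d" using x by (auto simp: C_def)
    then have "is_cycle ?Q (map (Pair u) x)" using cyc In_eq[OF d(1)] by (auto simp: In_def)
    then show ?thesis using is_cycle_map_Pair[OF T x(2)] by blast
  qed
  have factor: "path_cycle_factor (H u) (P u) (C u)" if u: "u \<in> verts T" for u
    unfolding path_cycle_factor_iff
  proof (intro conjI)
    show "P u \<inter> C u = {}"
    proof (rule equals0I)
      fix p assume "p \<in> P u \<inter> C u"
      then have "p \<noteq> []" "set p \<inter> set p = {}" using PC[of p u p] paths[of p u] by (auto simp: is_path_iff)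
      then show False by simp
    qed
    show "\<forall>x\<in>P u \<union> C u. \<forall>y\<in>P u \<union> C u. x \<noteq> y \<longrightarrow> set x \<inter> set y = {}"
      using PP CC PC by (metis Un_iff Int_commute)
    show "(\<Union>x\<in>P u \<union> C u. set x) = verts (H u)"
    proof
      show "(\<Union>x\<in>P u \<union> C u. set x) \<subseteq> verts (H u)"
      proof (intro UN_least)
        show "set x \<subseteq> verts (H u)" if "x \<in> P u \<union> C u" for x
          using that paths[of x u] cycles[of x u] u by (auto simp: is_path_iff is_cycle_iff)
      qed
      show "verts (H u) \<subseteq> (\<Union>x\<in>P u \<union> C u. set x)"
      proof
        fix x assume "x \<in> verts (H u)"
        then have "(u, x) \<in> verts ?Q" using u by (simp add: verts_composition)
        then obtain d where d: "d \<in> D" "(u, x) \<in> set d" using cover by blast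
        show "x \<in> (\<Union>x\<in>P u \<union> C u. set x)"
        proof (cases "d \<in> Out")
          case True
          then have "(u, x) \<in> set (expand (R d))" using R(2) d by simp
          then obtain p where "(u, p) \<in> set (R d)" "x \<in> set p" by (auto simp: set_expand)
          then show ?thesis using True by (auto simp: P_def)
        next
          case False
          then obtain v where "fst ` set d \<subseteq> {v}" using d by (auto simp: Out_def)
          moreover have "u \<in> fst ` set d" using d(2) by force
          ultimately have "d \<in> In u" using d(1) unfolding In_def by blast
          then have "map snd d \<in> C u" "x \<in> set (map snd d)" using d(2) by (force simp: C_def)+
          then show ?thesis by blast
        qed
      qed
    qed
  qed (use finP finIn paths cycles u in \<open>auto simp: C_def\<close>)
  \<comment> \<open>Contracts each run to its first vertex. Consecutive runs are joined by arcs of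
    \<open>T\<close>, so a crossing cycle becomes a cycle of the independent composition with one
    vertex per path, which bounds \<open>card (P u)\<close> by \<open>m_val\<close>.\<close>
  define rep where "rep d = map (\<lambda>(u, p). (u, hd p)) (R d)" for d
  have rep_sub: "set (rep d) \<subseteq> set d" if "d \<in> Out" for d
  proof
    fix y assume "y \<in> set (rep d)"
    then obtain u p where up: "(u, p) \<in> set (R d)" "y = (u, hd p)" by (auto simp: rep_def)
    then show "y \<in> set d" using Pd[OF that up(1)] by (auto simp: image_subset_iff)
  qed
  have "is_cycle ?K (rep d)" if d: "d \<in> Out" for d
    unfolding is_cycle_iff
  proof (intro conjI)
    have RT: "fst z \<in> verts T" if "z \<in> set (R d)" for z
    proof -
      have "closed_walk (arc T) (map fst (R d))" using R(4)[OF d] by (simp add: closed_walk_map)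
      then show ?thesis using closed_walk_set_verts[OF T] that by fastforce
    qed
    have RH: "hd (snd z) \<in> verts (H (fst z))" if "z \<in> set (R d)" for z
      using R(3)[OF d, of "fst z" "snd z"] that by (auto simp: is_path_iff subset_iff)
    show "set (rep d) \<subseteq> verts ?K" using RT RH by (force simp: rep_def verts_composition)
    have "closed_walk (\<lambda>x y. arc ?K (fst x, hd (snd x)) (fst y, hd (snd y))) (R d)"
      by (rule closed_walk_cong_set[OF R(4)[OF d]]) (use RT RH in \<open>simp add: arcs_composition\<close>)
    then show "closed_walk (arc ?K) (rep d)" by (simp add: rep_def closed_walk_map split_beta)
    have "distinct (map (\<lambda>(u, p). (u, hd p)) zs)"
      if "distinct (expand zs)" "\<And>u p. (u, p) \<in> set zs \<Longrightarrow> p \<noteq> []" for zs :: "('a \<times> 'b list) list"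
      using that
    proof (induction zs)
      case (Cons z zs)
      obtain u p where [simp]: "z = (u, p)" by fastforce
      have "(u, hd p) \<notin> (\<lambda>(u, p). (u, hd p)) ` set zs"
      proof
        assume "(u, hd p) \<in> (\<lambda>(u, p). (u, hd p)) ` set zs"
        then obtain q where q: "(u, q) \<in> set zs" "hd p = hd q" by auto
        have "set p \<inter> set q = {}"
          using Cons.prems(1) q(1) by (fastforce simp: set_expand)
        then show False
          using q Cons.prems(2)[of u p] Cons.prems(2)[of u q] by (auto dest: hd_in_set)
      qed
      then show ?case using Cons by auto
    qed simp
    then show "distinct (rep d)" using R(1)[OF d] Pd(1)[OF d] by (simp add: rep_def)
  qed
  moreover have "set (rep d) \<inter> set (rep e) = {}" if "d \<in> Out" "e \<in> Out" "rep d \<noteq> rep e" for d e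
    using rep_sub[OF that(1)] rep_sub[OF that(2)] disj[of d e] that by (auto simp: Out_def)
  ultimately have sub: "cycle_subdigraph ?K (rep ` Out)"
    using finOut by (auto simp: cycle_subdigraph_iff)
  have cardP: "card (P u) \<le> m_val T H u" if u: "u \<in> verts T" for u
  proof -
    have "inj_on (\<lambda>p. (u, hd p)) (P u)"
    proof (rule inj_onI, rule ccontr)
      fix p q assume *: "p \<in> P u" "q \<in> P u" "(u, hd p) = (u, hd q)" "p \<noteq> q"
      then have "p \<noteq> []" "q \<noteq> []" using paths[of p u] paths[of q u] by (simp_all add: is_path_iff)
      then have "hd p \<in> set p" "hd q \<in> set q" by simp_all
      then show False using PP[OF *(1,2,4)] *(3) by (metis Pair_inject disjoint_iff)
    qed
    then have "card (P u) = card ((\<lambda>p. (u, hd p)) ` P u)" by (simp add: card_image)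
    also have "\<dots> \<le> card ((\<Union>c\<in>rep ` Out. set c) \<inter> ({u} \<times> verts (H u)))"
    proof (rule card_mono)
      show "finite ((\<Union>c\<in>rep ` Out. set c) \<inter> ({u} \<times> verts (H u)))" using H[OF u] by simp
      show "(\<lambda>p. (u, hd p)) ` P u \<subseteq> (\<Union>c\<in>rep ` Out. set c) \<inter> ({u} \<times> verts (H u))"
      proof (intro subsetI IntI)
        fix y assume "y \<in> (\<lambda>p. (u, hd p)) ` P u"
        then obtain p d where p: "p \<in> P u" "y = (u, hd p)" "d \<in> Out" "(u, p) \<in> set (R d)"
          by (auto simp: P_def)
        then have "y \<in> set (rep d)" by (force simp: rep_def)
        then show "y \<in> (\<Union>c\<in>rep ` Out. set c)" using p(3) by blast
        show "y \<in> {u} \<times> verts (H u)" using paths[OF p(1)] p(2) by (auto simp: is_path_iff)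
      qed
    qed
    also have "\<dots> \<le> m_val T H u" by (rule m_val_greatest(1)[OF H[OF u] sub])
    finally show ?thesis .
  qed
  have "D = Out \<union> (\<Union>u\<in>verts T. In u)"
  proof
    show "D \<subseteq> Out \<union> (\<Union>u\<in>verts T. In u)"
    proof
      fix d assume d: "d \<in> D"
      show "d \<in> Out \<union> (\<Union>u\<in>verts T. In u)"
      proof (cases "d \<in> Out")
        case False
        then obtain u where "fst ` set d \<subseteq> {u}" using d by (auto simp: Out_def)
        moreover have "hd d \<in> set d" "set d \<subseteq> verts ?Q" using dne[OF d] cover d by auto
        ultimately have "fst ` set d = {u}" "u \<in> verts T" by (force simp: verts_composition)+
        then show ?thesis using d by (auto simp: In_def)
      qed simp
    qed
  qed (auto simp: Out_def In_def)
  moreover have "Out \<inter> (\<Union>u\<in>verts T. In u) = {}" using In_Out by blast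
  ultimately have "card D = card Out + card (\<Union>u\<in>verts T. In u)"
    using finOut finIn finT by (metis card_Un_disjoint finite_UN_I)
  also have "card (\<Union>u\<in>verts T. In u) = (\<Sum>u\<in>verts T. card (In u))"
    using finT finIn by (intro card_UN_disjoint) (auto simp: In_def)
  also have "\<dots> = (\<Sum>u\<in>verts T. card (C u))"
  proof (intro sum.cong refl)
    fix u
    have "inj_on (map snd) (In u)" using In_eq by (metis inj_onI)
    then show "card (In u) = card (C u)" by (simp add: C_def card_image)
  qed
  finally have cardD: "card D = card Out + (\<Sum>u\<in>verts T. card (C u))" .
  then have "card D = (\<Sum>u\<in>verts T. card (C u)) \<longrightarrow> (\<forall>u\<in>verts T. P u = {})"
    using finOut by (auto simp: P_def)
  then show ?thesis
    using factor cardP cardD by (intro exI[of _ P] exI[of _ C]) simp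
qed

theorem mainTheorem1:
  fixes T :: "'a digraph" and H :: "'a \<Rightarrow> 'b digraph"
  assumes "wf_digraph T" and "semicomplete T" and "card (verts T) \<ge> 2"
    and "\<forall>u\<in>verts T. wf_digraph (H u) \<and> verts (H u) \<noteq> {}"
    and "strong (composition T H)"
    and "\<exists>C. cycle_factor (composition T H) C"
  shows "k_min (composition T H) =
    1 + (\<Sum>u\<in>I_set T H. (LEAST j. eta (H u) j = enat (m_val T H u)))"
proof -
  let ?m = "m_val T H" and ?I = "I_set T H"
  define J where "J u = (LEAST j. eta (H u) j = enat (?m u))" for u
  have finT: "finite (verts T)" and finH: "\<And>u. u \<in> verts T \<Longrightarrow> finite (verts (H u))"
    using assms(1,4) by (auto simp: wf_digraph_def)
  have I_sub: "?I \<subseteq> verts T" by (auto simp: I_set_def)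
  obtain w where w: "closed_walk (arc T) w" "\<And>u. u \<in> verts T \<Longrightarrow> count (mset w) u = ?m u"
    and m1: "\<And>u. u \<in> verts T \<Longrightarrow> ?m u \<ge> 1"
    using ex_closed_walk_m_val[OF assms(1-4)] strong_composition_leaving_arc[OF assms(5)] assms(4)
    by blast
  have J_le: "J u \<le> card C"
    if u: "u \<in> ?I" "path_cycle_factor (H u) P C" "card P \<le> ?m u" for u P C
  proof -
    obtain j where "j \<le> card C" "eta (H u) j = enat (?m u)"
      using ex_eta_eq[OF u(2,3)] u(1) by (auto simp: I_set_def)
    then show ?thesis unfolding J_def by (meson Least_le order_trans)
  qed
  \<comment> \<open>When cycles alone cover the block, opening one of them gives a single path,
    which m_i \<ge> 1 permits; so one cycle fewer suffices.\<close>
  have J_less: "J u < card C" if u: "u \<in> ?I" "path_cycle_factor (H u) {} C" for u C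
  proof -
    have "C \<noteq> {}" using u assms(4) I_sub by (auto simp: path_cycle_factor_iff)
    then obtain c where c: "c \<in> C" by blast
    note b = path_cycle_factor_break_cycle[OF u(2) c]
    have "J u \<le> card (C - {c})" using b m1 u I_sub by (intro J_le[OF u(1) b(1)]) auto
    then show ?thesis using b(3) by simp
  qed
  have lower: "1 + (\<Sum>u\<in>?I. J u) \<le> card D" if D: "cycle_factor (composition T H) D" for D
  proof -
    obtain P C where PC: "\<forall>u\<in>verts T. path_cycle_factor (H u) (P u) (C u) \<and> card (P u) \<le> ?m u"
      "(\<Sum>u\<in>verts T. card (C u)) \<le> card D"
      "card D = (\<Sum>u\<in>verts T. card (C u)) \<longrightarrow> (\<forall>u\<in>verts T. P u = {})"
      using cycle_factor_restricts_to_blocks[where H = H, OF assms(1) finH D] by blast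
    define J' where "J' u = (if u \<in> ?I then J u else 0)" for u
    have sumJ: "(\<Sum>u\<in>?I. J u) = (\<Sum>u\<in>verts T. J' u)"
      unfolding J'_def using finT I_sub by (simp add: sum.inter_restrict[symmetric] Int_absorb1)
    have le: "J' u \<le> card (C u)" if "u \<in> verts T" for u
      using J_le[of u "P u" "C u"] PC(1) that by (simp add: J'_def)
    show ?thesis
    proof (cases "card D = (\<Sum>u\<in>verts T. card (C u))")
      case True
      \<comment> \<open>No cycle crosses between blocks here, so the summand 1 must come from
        strictness: outside \<open>I_set\<close> because \<open>C u\<close> is nonempty, inside by
        \<open>J_less\<close>.\<close>
      have "J' u < card (C u)" if u: "u \<in> verts T" for u
      proof -
        have f: "path_cycle_factor (H u) {} (C u)" using PC(1,3) True u by force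
        then have "C u \<noteq> {}" "finite (C u)" using assms(4) u by (auto simp: path_cycle_factor_iff)
        then show ?thesis using J_less[OF _ f] by (simp add: J'_def card_gt_0_iff)
      qed
      moreover have "verts T \<noteq> {}" using assms(3) by auto
      ultimately have "(\<Sum>u\<in>verts T. J' u) < (\<Sum>u\<in>verts T. card (C u))"
        by (intro sum_strict_mono[OF finT])
      then show ?thesis using True sumJ by simp
    next
      case False
      have "(\<Sum>u\<in>verts T. J' u) \<le> (\<Sum>u\<in>verts T. card (C u))" using le by (rule sum_mono)
      then show ?thesis using False PC(2) sumJ by simp
    qed
  qed
  have "\<exists>P C. path_cycle_factor (H u) P C \<and> card P = ?m u \<and> card C = (if u \<in> ?I then J u else 0)"
    if u: "u \<in> verts T" for u
  proof (cases "u \<in> ?I")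
    case True
    \<comment> \<open>The given cycle factor, restricted to the block, shows that some
      \<open>j\<close> satisfies the equation, so that the \<open>LEAST\<close> does too.\<close>
    obtain D where "cycle_factor (composition T H) D" using assms(6) by blast
    then obtain P C where "path_cycle_factor (H u) P C" "card P \<le> ?m u"
      using cycle_factor_restricts_to_blocks[where H = H, OF assms(1) finH] u by blast
    then obtain j where "eta (H u) j = enat (?m u)"
      using ex_eta_eq True by (fastforce simp: I_set_def)
    then have "eta (H u) (J u) = enat (?m u)" unfolding J_def by (rule LeastI)
    from eta_eq_enatD[OF this] show ?thesis using True by auto
  next
    case False
    have "?m u \<le> card (verts (H u))"
    proof -
      obtain C :: "('a \<times> 'b) list set"
        where "?m u = card ((\<Union>c\<in>C. set c) \<inter> ({u} \<times> verts (H u)))"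
        using m_val_greatest(2)[where H = H and u = u and T = T, OF finH[OF u]] by blast
      also have "\<dots> \<le> card ({u} \<times> verts (H u))" using finH[OF u] by (intro card_mono) auto
      finally show ?thesis by (simp add: card_cartesian_product_singleton)
    qed
    moreover have "pc (H u) \<le> ?m u" using False u by (simp add: I_set_def)
    ultimately obtain P where "path_cycle_factor (H u) P {}" "card P = ?m u"
      using ex_path_factor_card[OF finH[OF u]] by blast
    then show ?thesis using False by (intro exI[of _ P] exI[of _ "{}"]) simp
  qed
  then obtain P C where PC: "\<And>u. u \<in> verts T \<Longrightarrow> path_cycle_factor (H u) (P u) (C u)"
    "\<And>u. u \<in> verts T \<Longrightarrow> card (P u) = ?m u"
    "\<And>u. u \<in> verts T \<Longrightarrow> card (C u) = (if u \<in> ?I then J u else 0)" by metis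
  have "\<exists>D. cycle_factor (composition T H) D \<and> card D = 1 + (\<Sum>u\<in>verts T. card (C u))"
    by (rule cycle_factor_upper[OF assms(1) w(1) PC(1)]) (simp_all add: PC(2) w(2))
  then obtain D where D: "cycle_factor (composition T H) D"
    "card D = 1 + (\<Sum>u\<in>verts T. card (C u))" by blast
  have "(\<Sum>u\<in>verts T. card (C u)) = (\<Sum>u\<in>?I. J u)"
    using finT I_sub PC(3) by (simp add: sum.inter_restrict[symmetric] Int_absorb1)
  then have "\<exists>D. cycle_factor (composition T H) D \<and> card D = 1 + (\<Sum>u\<in>?I. J u)" using D by auto
  then have "k_min (composition T H) = 1 + (\<Sum>u\<in>?I. J u)"
    unfolding k_min_def using lower by (intro Least_equality) auto
  then show ?thesis by (simp add: J_def)
qed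

end
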